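(* Let $M|N$ be a left D2 ring extension with left D2 quasibasis $b_i\in(M\otimes_NM)^N$, $\beta_i\in A=\mathrm{End}({}_NM_N)$, and let $R=C_M(N)$. Let $M\rtimes A$ be the smash product ring: the additive group $M\otimes_RA$ with elements written $m\rtimes\alpha$ and multiplication $$(m\rtimes\alpha)(m'\rtimes\alpha')=m\,\alpha_{(1)}(m')\rtimes\alpha_{(2)}\circ\alpha',\qquad \alpha_{(1)}\otimes\alpha_{(2)}=\Delta_A(\alpha)=\sum_i\alpha(-\,b_i^1)b_i^2\otimes_R\beta_i .$$ Then $m\rtimes\alpha\mapsto\lambda(m)\circ\alpha$ is a ring isomorphism $M\rtimes A\cong\mathrm{End}(M_N)$.
   Context: Rings are unital; a ring extension $M|N$ is a unital ring homomorphism $N\to M$. $M|N$ is left D2 if $M\otimes_NM$ is isomorphic as an $N$-$M$-bimodule to a direct summand of $\oplus^n\,{}_NM_M$ for some $n\ge1$; equivalently there is a left D2 quasibasis: finitely many $b_i=b_i^1\otimes b_i^2\in(M\otimes_NM)^N$ (summation suppressed) and $\beta_i\in\mathrm{End}({}_NM_N)$ with $\sum_ib_i^1\otimes b_i^2\beta_i(m)=m\otimes1$ for all $m\in M$. Here $X^N$ denotes the elements of an $N$-$N$-bimodule $X$ commuting with $N$, and $C_M(N)=M^N$. $\lambda(m)$ is left multiplication by $m$. $M$ is a right $R$-module by multiplication, and $A$ is an $R$-$R$-bimodule by $(r\cdot\alpha\cdot r')(m)=r\alpha(m)r'$. $\alpha(-b_i^1)b_i^2$ denotes the map $m\mapsto\alpha(mb_i^1)b_i^2$.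 *)

theory Defs
  imports "HOL-Algebra.Free_Abelian_Groups" "HOL-Algebra.QuotRing"
begin

section \<open>Balanced tensor products\<close>

text \<open>
  \<open>G\<close> and \<open>H\<close> are abelian groups (written multiplicatively; for a ring we pass its \<^const>\<open>add_monoid\<close>),
  \<open>act_r\<close> is a right action of the scalars \<open>S\<close> on \<open>G\<close> and \<open>act_l\<close> a left action of \<open>S\<close> on \<open>H\<close>.
  The tensor product of \<open>G\<close> and \<open>H\<close> over \<open>S\<close> is the free abelian group on \<open>G \<times> H\<close> modulo the usual
  relations.  It is again a multiplicatively written group, so finite sums are
  \<^const>\<open>finprod\<close>s.
\<close>

definition tensor_relations ::
  "('g, 'a) monoid_scheme \<Rightarrow> ('h, 'b) monoid_scheme \<Rightarrow> 's set \<Rightarrow> ('g \<Rightarrow> 's \<Rightarrow> 'g) \<Rightarrow> ('s \<Rightarrow> 'h \<Rightarrow> 'h)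
    \<Rightarrow> (('g \<times> 'h) \<Rightarrow>\<^sub>0 int) set" where
  "tensor_relations G H S act_r act_l =
     {frag_of (x \<otimes>\<^bsub>G\<^esub> x', y) - frag_of (x, y) - frag_of (x', y) | x x' y.
        x \<in> carrier G \<and> x' \<in> carrier G \<and> y \<in> carrier H} \<union>
     {frag_of (x, y \<otimes>\<^bsub>H\<^esub> y') - frag_of (x, y) - frag_of (x, y') | x y y'.
        x \<in> carrier G \<and> y \<in> carrier H \<and> y' \<in> carrier H} \<union>
     {frag_of (act_r x s, y) - frag_of (x, act_l s y) | x s y.
        x \<in> carrier G \<and> s \<in> S \<and> y \<in> carrier H}"

definition tensor_kernel ::
  "('g, 'a) monoid_scheme \<Rightarrow> ('h, 'b) monoid_scheme \<Rightarrow> 's set \<Rightarrow> ('g \<Rightarrow> 's \<Rightarrow> 'g) \<Rightarrow> ('s \<Rightarrow> 'h \<Rightarrow> 'h)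
    \<Rightarrow> (('g \<times> 'h) \<Rightarrow>\<^sub>0 int) set" where
  "tensor_kernel G H S act_r act_l =
     generate (free_Abelian_group (carrier G \<times> carrier H)) (tensor_relations G H S act_r act_l)"

definition tensor_product ::
  "('g, 'a) monoid_scheme \<Rightarrow> ('h, 'b) monoid_scheme \<Rightarrow> 's set \<Rightarrow> ('g \<Rightarrow> 's \<Rightarrow> 'g) \<Rightarrow> ('s \<Rightarrow> 'h \<Rightarrow> 'h)
    \<Rightarrow> (('g \<times> 'h) \<Rightarrow>\<^sub>0 int) set monoid" where
  "tensor_product G H S act_r act_l =
     free_Abelian_group (carrier G \<times> carrier H) Mod tensor_kernel G H S act_r act_l"

definition pure_tensor ::
  "('g, 'a) monoid_scheme \<Rightarrow> ('h, 'b) monoid_scheme \<Rightarrow> 's set \<Rightarrow> ('g \<Rightarrow> 's \<Rightarrow> 'g) \<Rightarrow> ('s \<Rightarrow> 'h \<Rightarrow> 'h)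
    \<Rightarrow> 'g \<Rightarrow> 'h \<Rightarrow> (('g \<times> 'h) \<Rightarrow>\<^sub>0 int) set" where
  "pure_tensor G H S act_r act_l x y =
     tensor_kernel G H S act_r act_l #>\<^bsub>free_Abelian_group (carrier G \<times> carrier H)\<^esub> frag_of (x, y)"

text \<open>
  The value at \<open>X\<close> of the additive map into \<open>K\<close> induced by \<open>f\<close>, i.e. sending the tensor of
  \<open>x\<close> and \<open>y\<close> to \<open>f x y\<close>: extend \<open>f\<close> to formal \<open>\<int>\<close>-linear combinations of pairs and apply it to a
  representative.  This is meaningful if \<open>f\<close> is biadditive and balanced, for then all
  representatives of \<open>X\<close> give the same value.
\<close>

definition tensor_lift ::
  "('k, 'c) monoid_scheme \<Rightarrow> ('g \<Rightarrow> 'h \<Rightarrow> 'k) \<Rightarrow> (('g \<times> 'h) \<Rightarrow>\<^sub>0 int) set \<Rightarrow> 'k" where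
  "tensor_lift K f X =
     the_elem ((\<lambda>z. \<Otimes>\<^bsub>K\<^esub>p\<in>Poly_Mapping.keys z.
                  f (fst p) (snd p) [^]\<^bsub>K\<^esub> Poly_Mapping.lookup z p) ` X)"


section \<open>The bimodule \<open>M \<otimes>\<^sub>N M\<close>\<close>

text \<open>Throughout, a ring extension \<open>M|N\<close> is a ring homomorphism \<open>phi\<close> from \<open>N\<close> to \<open>M\<close>, not
  necessarily injective; \<open>N\<close> acts on \<open>M\<close> through \<open>phi\<close>.\<close>

definition MM_tensor ::
  "('m, 'a) ring_scheme \<Rightarrow> ('n, 'b) ring_scheme \<Rightarrow> ('n \<Rightarrow> 'm) \<Rightarrow> (('m \<times> 'm) \<Rightarrow>\<^sub>0 int) set monoid" where
  "MM_tensor M N phi =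
     tensor_product (add_monoid M) (add_monoid M) (carrier N)
       (\<lambda>x n. x \<otimes>\<^bsub>M\<^esub> phi n) (\<lambda>n y. phi n \<otimes>\<^bsub>M\<^esub> y)"

definition MM_pure ::
  "('m, 'a) ring_scheme \<Rightarrow> ('n, 'b) ring_scheme \<Rightarrow> ('n \<Rightarrow> 'm) \<Rightarrow> 'm \<Rightarrow> 'm \<Rightarrow> (('m \<times> 'm) \<Rightarrow>\<^sub>0 int) set" where
  "MM_pure M N phi =
     pure_tensor (add_monoid M) (add_monoid M) (carrier N)
       (\<lambda>x n. x \<otimes>\<^bsub>M\<^esub> phi n) (\<lambda>n y. phi n \<otimes>\<^bsub>M\<^esub> y)"

definition MM_lmult ::
  "('m, 'a) ring_scheme \<Rightarrow> ('n, 'b) ring_scheme \<Rightarrow> ('n \<Rightarrow> 'm)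
    \<Rightarrow> 'm \<Rightarrow> (('m \<times> 'm) \<Rightarrow>\<^sub>0 int) set \<Rightarrow> (('m \<times> 'm) \<Rightarrow>\<^sub>0 int) set" where
  "MM_lmult M N phi m X =
     tensor_lift (MM_tensor M N phi) (\<lambda>x y. MM_pure M N phi (m \<otimes>\<^bsub>M\<^esub> x) y) X"

definition MM_rmult ::
  "('m, 'a) ring_scheme \<Rightarrow> ('n, 'b) ring_scheme \<Rightarrow> ('n \<Rightarrow> 'm)
    \<Rightarrow> (('m \<times> 'm) \<Rightarrow>\<^sub>0 int) set \<Rightarrow> 'm \<Rightarrow> (('m \<times> 'm) \<Rightarrow>\<^sub>0 int) set" where
  "MM_rmult M N phi X m =
     tensor_lift (MM_tensor M N phi) (\<lambda>x y. MM_pure M N phi x (y \<otimes>\<^bsub>M\<^esub> m)) X"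

definition MM_centralizer ::
  "('m, 'a) ring_scheme \<Rightarrow> ('n, 'b) ring_scheme \<Rightarrow> ('n \<Rightarrow> 'm) \<Rightarrow> (('m \<times> 'm) \<Rightarrow>\<^sub>0 int) set set" where
  "MM_centralizer M N phi =
     {X \<in> carrier (MM_tensor M N phi).
        \<forall>n\<in>carrier N. MM_lmult M N phi (phi n) X = MM_rmult M N phi X (phi n)}"


section \<open>The rings \<open>R\<close>, \<open>A\<close> and \<open>End(M\<^sub>N)\<close>\<close>

definition ext_centralizer ::
  "('m, 'a) ring_scheme \<Rightarrow> ('n, 'b) ring_scheme \<Rightarrow> ('n \<Rightarrow> 'm) \<Rightarrow> 'm set" where
  "ext_centralizer M N phi =
     {r \<in> carrier M. \<forall>n\<in>carrier N. phi n \<otimes>\<^bsub>M\<^esub> r = r \<otimes>\<^bsub>M\<^esub> phi n}"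

text \<open>Endomorphisms are extensional functions, so that equality on \<open>carrier M\<close> is equality.\<close>

definition End_right_carrier ::
  "('m, 'a) ring_scheme \<Rightarrow> ('n, 'b) ring_scheme \<Rightarrow> ('n \<Rightarrow> 'm) \<Rightarrow> ('m \<Rightarrow> 'm) set" where
  "End_right_carrier M N phi =
     {f \<in> hom (add_monoid M) (add_monoid M) \<inter> extensional (carrier M).
        \<forall>n\<in>carrier N. \<forall>x\<in>carrier M. f (x \<otimes>\<^bsub>M\<^esub> phi n) = f x \<otimes>\<^bsub>M\<^esub> phi n}"

definition End_bimod_carrier ::
  "('m, 'a) ring_scheme \<Rightarrow> ('n, 'b) ring_scheme \<Rightarrow> ('n \<Rightarrow> 'm) \<Rightarrow> ('m \<Rightarrow> 'm) set" where
  "End_bimod_carrier M N phi =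
     {f \<in> End_right_carrier M N phi.
        \<forall>n\<in>carrier N. \<forall>x\<in>carrier M. f (phi n \<otimes>\<^bsub>M\<^esub> x) = phi n \<otimes>\<^bsub>M\<^esub> f x}"

definition endo_ring_on :: "('m, 'a) ring_scheme \<Rightarrow> ('m \<Rightarrow> 'm) set \<Rightarrow> ('m \<Rightarrow> 'm) ring" where
  "endo_ring_on M E =
     \<lparr>carrier = E,
      monoid.mult = compose (carrier M),
      one = (\<lambda>x\<in>carrier M. x),
      zero = (\<lambda>x\<in>carrier M. \<zero>\<^bsub>M\<^esub>),
      add = (\<lambda>f g. \<lambda>x\<in>carrier M. f x \<oplus>\<^bsub>M\<^esub> g x)\<rparr>"

definition End_right ::
  "('m, 'a) ring_scheme \<Rightarrow> ('n, 'b) ring_scheme \<Rightarrow> ('n \<Rightarrow> 'm) \<Rightarrow> ('m \<Rightarrow> 'm) ring" where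
  "End_right M N phi = endo_ring_on M (End_right_carrier M N phi)"

definition End_bimod ::
  "('m, 'a) ring_scheme \<Rightarrow> ('n, 'b) ring_scheme \<Rightarrow> ('n \<Rightarrow> 'm) \<Rightarrow> ('m \<Rightarrow> 'm) ring" where
  "End_bimod M N phi = endo_ring_on M (End_bimod_carrier M N phi)"

definition left_mult :: "('m, 'a) ring_scheme \<Rightarrow> 'm \<Rightarrow> 'm \<Rightarrow> 'm" where
  "left_mult M m = (\<lambda>x\<in>carrier M. m \<otimes>\<^bsub>M\<^esub> x)"

definition A_lact :: "('m, 'a) ring_scheme \<Rightarrow> 'm \<Rightarrow> ('m \<Rightarrow> 'm) \<Rightarrow> 'm \<Rightarrow> 'm" where
  "A_lact M r f = (\<lambda>x\<in>carrier M. r \<otimes>\<^bsub>M\<^esub> f x)"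

definition A_ract :: "('m, 'a) ring_scheme \<Rightarrow> ('m \<Rightarrow> 'm) \<Rightarrow> 'm \<Rightarrow> 'm \<Rightarrow> 'm" where
  "A_ract M f r = (\<lambda>x\<in>carrier M. f x \<otimes>\<^bsub>M\<^esub> r)"


section \<open>Left depth two\<close>

text \<open>The direct sum of \<open>n\<close> copies of \<open>M\<close>, with componentwise actions; a direct summand is a
  sub-bimodule \<open>S\<close> having a complementary sub-bimodule \<open>T\<close>.\<close>

definition M_power :: "('m, 'a) ring_scheme \<Rightarrow> nat \<Rightarrow> (nat \<Rightarrow> 'm) monoid" where
  "M_power M n = product_group {..<n} (\<lambda>_. add_monoid M)"

definition power_lmult :: "('m, 'a) ring_scheme \<Rightarrow> nat \<Rightarrow> 'm \<Rightarrow> (nat \<Rightarrow> 'm) \<Rightarrow> nat \<Rightarrow> 'm" where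
  "power_lmult M n m v = (\<lambda>i\<in>{..<n}. m \<otimes>\<^bsub>M\<^esub> v i)"

definition power_rmult :: "('m, 'a) ring_scheme \<Rightarrow> nat \<Rightarrow> (nat \<Rightarrow> 'm) \<Rightarrow> 'm \<Rightarrow> nat \<Rightarrow> 'm" where
  "power_rmult M n v m = (\<lambda>i\<in>{..<n}. v i \<otimes>\<^bsub>M\<^esub> m)"

definition power_subbimodule ::
  "('m, 'a) ring_scheme \<Rightarrow> ('n, 'b) ring_scheme \<Rightarrow> ('n \<Rightarrow> 'm) \<Rightarrow> nat \<Rightarrow> (nat \<Rightarrow> 'm) set \<Rightarrow> bool" where
  "power_subbimodule M N phi n S \<longleftrightarrow>
     subgroup S (M_power M n) \<and>
     (\<forall>v\<in>S. \<forall>a\<in>carrier N. power_lmult M n (phi a) v \<in> S) \<and>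
     (\<forall>v\<in>S. \<forall>m\<in>carrier M. power_rmult M n v m \<in> S)"

definition left_D2 :: "('m, 'a) ring_scheme \<Rightarrow> ('n, 'b) ring_scheme \<Rightarrow> ('n \<Rightarrow> 'm) \<Rightarrow> bool" where
  "left_D2 M N phi \<longleftrightarrow>
     (\<exists>n\<ge>1. \<exists>S T f.
        power_subbimodule M N phi n S \<and> power_subbimodule M N phi n T \<and>
        S \<inter> T = {\<one>\<^bsub>M_power M n\<^esub>} \<and> S <#>\<^bsub>M_power M n\<^esub> T = carrier (M_power M n) \<and>
        f \<in> iso (MM_tensor M N phi) ((M_power M n)\<lparr>carrier := S\<rparr>) \<and>
        (\<forall>X\<in>carrier (MM_tensor M N phi). \<forall>a\<in>carrier N.
           f (MM_lmult M N phi (phi a) X) = power_lmult M n (phi a) (f X)) \<and>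
        (\<forall>X\<in>carrier (MM_tensor M N phi). \<forall>m\<in>carrier M.
           f (MM_rmult M N phi X m) = power_rmult M n (f X) m))"

definition left_D2_quasibasis ::
  "('m, 'a) ring_scheme \<Rightarrow> ('n, 'b) ring_scheme \<Rightarrow> ('n \<Rightarrow> 'm)
    \<Rightarrow> 'i set \<Rightarrow> ('i \<Rightarrow> (('m \<times> 'm) \<Rightarrow>\<^sub>0 int) set) \<Rightarrow> ('i \<Rightarrow> 'm \<Rightarrow> 'm) \<Rightarrow> bool" where
  "left_D2_quasibasis M N phi I b \<beta> \<longleftrightarrow>
     finite I \<and>
     b \<in> I \<rightarrow> MM_centralizer M N phi \<and>
     \<beta> \<in> I \<rightarrow> carrier (End_bimod M N phi) \<and>
     (\<forall>m\<in>carrier M.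
        (\<Otimes>\<^bsub>MM_tensor M N phi\<^esub>i\<in>I. MM_rmult M N phi (b i) (\<beta> i m)) = MM_pure M N phi m \<one>\<^bsub>M\<^esub>)"


section \<open>The coproduct of \<open>A\<close> and the smash product\<close>

definition AA_tensor ::
  "('m, 'a) ring_scheme \<Rightarrow> ('n, 'b) ring_scheme \<Rightarrow> ('n \<Rightarrow> 'm)
    \<Rightarrow> ((('m \<Rightarrow> 'm) \<times> ('m \<Rightarrow> 'm)) \<Rightarrow>\<^sub>0 int) set monoid" where
  "AA_tensor M N phi =
     tensor_product (add_monoid (End_bimod M N phi)) (add_monoid (End_bimod M N phi))
       (ext_centralizer M N phi) (A_ract M) (A_lact M)"

definition AA_pure ::
  "('m, 'a) ring_scheme \<Rightarrow> ('n, 'b) ring_scheme \<Rightarrow> ('n \<Rightarrow> 'm)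
    \<Rightarrow> ('m \<Rightarrow> 'm) \<Rightarrow> ('m \<Rightarrow> 'm) \<Rightarrow> ((('m \<Rightarrow> 'm) \<times> ('m \<Rightarrow> 'm)) \<Rightarrow>\<^sub>0 int) set" where
  "AA_pure M N phi =
     pure_tensor (add_monoid (End_bimod M N phi)) (add_monoid (End_bimod M N phi))
       (ext_centralizer M N phi) (A_ract M) (A_lact M)"

text \<open>The map \<open>\<alpha>(- b\<^sup>1) b\<^sup>2\<close> for \<open>b = b\<^sup>1 \<otimes> b\<^sup>2\<close> (summation suppressed).\<close>

definition insert_tensor ::
  "('m, 'a) ring_scheme \<Rightarrow> ('m \<Rightarrow> 'm) \<Rightarrow> (('m \<times> 'm) \<Rightarrow>\<^sub>0 int) set \<Rightarrow> 'm \<Rightarrow> 'm" where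
  "insert_tensor M \<alpha> b =
     (\<lambda>m\<in>carrier M. tensor_lift (add_monoid M) (\<lambda>x y. \<alpha> (m \<otimes>\<^bsub>M\<^esub> x) \<otimes>\<^bsub>M\<^esub> y) b)"

definition coproduct ::
  "('m, 'a) ring_scheme \<Rightarrow> ('n, 'b) ring_scheme \<Rightarrow> ('n \<Rightarrow> 'm)
    \<Rightarrow> 'i set \<Rightarrow> ('i \<Rightarrow> (('m \<times> 'm) \<Rightarrow>\<^sub>0 int) set) \<Rightarrow> ('i \<Rightarrow> 'm \<Rightarrow> 'm)
    \<Rightarrow> ('m \<Rightarrow> 'm) \<Rightarrow> ((('m \<Rightarrow> 'm) \<times> ('m \<Rightarrow> 'm)) \<Rightarrow>\<^sub>0 int) set" where
  "coproduct M N phi I b \<beta> \<alpha> =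
     (\<Otimes>\<^bsub>AA_tensor M N phi\<^esub>i\<in>I. AA_pure M N phi (insert_tensor M \<alpha> (b i)) (\<beta> i))"

definition MA_tensor ::
  "('m, 'a) ring_scheme \<Rightarrow> ('n, 'b) ring_scheme \<Rightarrow> ('n \<Rightarrow> 'm)
    \<Rightarrow> (('m \<times> ('m \<Rightarrow> 'm)) \<Rightarrow>\<^sub>0 int) set monoid" where
  "MA_tensor M N phi =
     tensor_product (add_monoid M) (add_monoid (End_bimod M N phi))
       (ext_centralizer M N phi) (mult M) (A_lact M)"

definition smash ::
  "('m, 'a) ring_scheme \<Rightarrow> ('n, 'b) ring_scheme \<Rightarrow> ('n \<Rightarrow> 'm)
    \<Rightarrow> 'm \<Rightarrow> ('m \<Rightarrow> 'm) \<Rightarrow> (('m \<times> ('m \<Rightarrow> 'm)) \<Rightarrow>\<^sub>0 int) set" where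
  "smash M N phi =
     pure_tensor (add_monoid M) (add_monoid (End_bimod M N phi))
       (ext_centralizer M N phi) (mult M) (A_lact M)"

text \<open>\<open>m \<alpha>\<^sub>(\<^sub>1\<^sub>)(m') \<rtimes> \<alpha>\<^sub>(\<^sub>2\<^sub>) \<circ> \<alpha>'\<close>, with \<open>\<alpha>\<^sub>(\<^sub>1\<^sub>) \<otimes> \<alpha>\<^sub>(\<^sub>2\<^sub>)\<close> the coproduct of \<open>\<alpha>\<close>.\<close>

definition smash_mult_pure ::
  "('m, 'a) ring_scheme \<Rightarrow> ('n, 'b) ring_scheme \<Rightarrow> ('n \<Rightarrow> 'm)
    \<Rightarrow> 'i set \<Rightarrow> ('i \<Rightarrow> (('m \<times> 'm) \<Rightarrow>\<^sub>0 int) set) \<Rightarrow> ('i \<Rightarrow> 'm \<Rightarrow> 'm)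
    \<Rightarrow> 'm \<Rightarrow> ('m \<Rightarrow> 'm) \<Rightarrow> 'm \<Rightarrow> ('m \<Rightarrow> 'm) \<Rightarrow> (('m \<times> ('m \<Rightarrow> 'm)) \<Rightarrow>\<^sub>0 int) set" where
  "smash_mult_pure M N phi I b \<beta> m \<alpha> m' \<alpha>' =
     tensor_lift (MA_tensor M N phi)
       (\<lambda>\<alpha>1 \<alpha>2. smash M N phi (m \<otimes>\<^bsub>M\<^esub> \<alpha>1 m') (compose (carrier M) \<alpha>2 \<alpha>'))
       (coproduct M N phi I b \<beta> \<alpha>)"

definition smash_product ::
  "('m, 'a) ring_scheme \<Rightarrow> ('n, 'b) ring_scheme \<Rightarrow> ('n \<Rightarrow> 'm)
    \<Rightarrow> 'i set \<Rightarrow> ('i \<Rightarrow> (('m \<times> 'm) \<Rightarrow>\<^sub>0 int) set) \<Rightarrow> ('i \<Rightarrow> 'm \<Rightarrow> 'm)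
    \<Rightarrow> (('m \<times> ('m \<Rightarrow> 'm)) \<Rightarrow>\<^sub>0 int) set ring" where
  "smash_product M N phi I b \<beta> =
     \<lparr>carrier = carrier (MA_tensor M N phi),
      monoid.mult = (\<lambda>X Y.
        tensor_lift (MA_tensor M N phi)
          (\<lambda>m \<alpha>. tensor_lift (MA_tensor M N phi) (smash_mult_pure M N phi I b \<beta> m \<alpha>) Y) X),
      one = smash M N phi \<one>\<^bsub>M\<^esub> \<one>\<^bsub>End_bimod M N phi\<^esub>,
      zero = \<one>\<^bsub>MA_tensor M N phi\<^esub>,
      add = mult (MA_tensor M N phi)\<rparr>"

definition smash_to_End ::
  "('m, 'a) ring_scheme \<Rightarrow> ('n, 'b) ring_scheme \<Rightarrow> ('n \<Rightarrow> 'm)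
    \<Rightarrow> (('m \<times> ('m \<Rightarrow> 'm)) \<Rightarrow>\<^sub>0 int) set \<Rightarrow> 'm \<Rightarrow> 'm" where
  "smash_to_End M N phi =
     tensor_lift (add_monoid (End_right M N phi)) (\<lambda>m \<alpha>. compose (carrier M) (left_mult M m) \<alpha>)"

end

theory Submission
  imports Defs
begin

text \<open>
  Write \<open>\<Phi>\<close> for the additive map sending \<open>m \<rtimes> \<alpha>\<close> to \<open>\<lambda>(m) \<circ> \<alpha>\<close>.  Applying \<open>f \<otimes> id\<close> and then
  multiplication to the quasibasis equation gives \<open>\<Sum>\<^sub>i f(b\<^sub>i\<^sup>1) b\<^sub>i\<^sup>2 \<beta>\<^sub>i(x) = f(x)\<close> for every right
  \<open>N\<close>-linear \<open>f\<close>, so \<open>\<Psi>(f) = \<Sum>\<^sub>i f(b\<^sub>i\<^sup>1) b\<^sub>i\<^sup>2 \<rtimes> \<beta>\<^sub>i\<close> is a right inverse of \<open>\<Phi>\<close>.  It is also a left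
  inverse, because \<open>\<alpha>(b\<^sub>i\<^sup>1) b\<^sub>i\<^sup>2\<close> lies in \<open>R\<close> for \<open>\<alpha> \<in> A\<close> and can be moved across the tensor sign.
  The same identity, applied to \<open>f = \<alpha> \<circ> \<lambda>(m')\<close>, shows that \<open>\<Phi>\<close> takes the product of two pure tensors
  to the composite of their images.  As \<open>\<Phi>\<close> is injective, this already forces the product to
  be well defined on the tensor product, and the ring axioms are transported from \<open>End(M\<^sub>N)\<close>.
\<close>

section \<open>The universal property of the balanced tensor product\<close>

text \<open>The homomorphism out of the free abelian group that extends \<open>f\<close>. It repeats
  the product inside \<open>tensor_lift\<close>, so that \<open>tensor_lift\<close> becomes the
  common value of such a homomorphism on a coset.\<close>

definition frag_extend :: "('k, 'c) monoid_scheme \<Rightarrow> ('p \<Rightarrow> 'k) \<Rightarrow> ('p \<Rightarrow>\<^sub>0 int) \<Rightarrow> 'k" where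
  "frag_extend K f z = (\<Otimes>\<^bsub>K\<^esub>p\<in>Poly_Mapping.keys z. f p [^]\<^bsub>K\<^esub> Poly_Mapping.lookup z p)"

lemma (in comm_group) frag_extend_hom:
  assumes "\<And>p. p \<in> P \<Longrightarrow> f p \<in> carrier G"
  shows "frag_extend G f \<in> hom (free_Abelian_group P) G" (is "?h \<in> _")
proof (rule homI)
  fix x assume "x \<in> carrier (free_Abelian_group P)"
  then show "?h x \<in> carrier G"
    using assms by (auto simp: frag_extend_def intro!: finprod_closed)
next
  \<comment> \<open>Cancellation can make the keys of a sum smaller than the union of the keys.
    Additional points have coefficient 0 and contribute the factor 1, so all products can be taken
    over one common set.\<close>
  have ext: "?h z = (\<Otimes>p\<in>F. f p [^] Poly_Mapping.lookup z p)"
    if "Poly_Mapping.keys z \<subseteq> F" "finite F" "F \<subseteq> P" for z F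
    unfolding frag_extend_def by (rule finprod_mono_neutral_cong_left)
      (use that assms in \<open>auto simp: in_keys_iff\<close>)
  fix x y assume xy: "x \<in> carrier (free_Abelian_group P)" "y \<in> carrier (free_Abelian_group P)"
  let ?F = "Poly_Mapping.keys x \<union> Poly_Mapping.keys y"
  have F: "?F \<subseteq> P" "finite ?F" "Poly_Mapping.keys (x + y) \<subseteq> ?F"
    using xy keys_add[of x y] by auto
  have "?h (x + y) = (\<Otimes>p\<in>?F. f p [^] Poly_Mapping.lookup x p \<otimes> f p [^] Poly_Mapping.lookup y p)"
    unfolding ext[OF F(3,2,1)]
    by (rule finprod_cong) (use F assms in \<open>auto simp: lookup_add int_pow_mult subset_iff simp_implies_def\<close>)
  also have "\<dots> = ?h x \<otimes> ?h y"
    using F assms by (subst finprod_multf) (auto simp: ext[of _ ?F] subset_iff)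
  finally show "?h (x \<otimes>\<^bsub>free_Abelian_group P\<^esub> y) = ?h x \<otimes> ?h y"
    by simp
qed

lemma (in comm_group) frag_extend_frag_of: "f p \<in> carrier G \<Longrightarrow> frag_extend G f (frag_of p) = f p"
  by (simp add: frag_extend_def)

lemma tensor_lift_eq: "tensor_lift K f X = the_elem (frag_extend K (\<lambda>p. f (fst p) (snd p)) ` X)"
  by (simp add: tensor_lift_def frag_extend_def)

text \<open>\<open>h\<close> kills \<open>C\<close>, so it takes one value on all representatives,
  and the identity in \<open>C\<close> makes the coset nonempty. The image is thus a singleton, as
  \<open>the_elem\<close> requires.\<close>

lemma (in group_hom) constant_on_kernel_coset:
  assumes "C \<subseteq> kernel G H h" "\<one> \<in> C" "x \<in> carrier G"
  shows "h ` (C #> x) = {h x}"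
proof
  show "h ` (C #> x) \<subseteq> {h x}"
    using assms by (auto simp: r_coset_def kernel_def subset_iff)
  show "{h x} \<subseteq> h ` (C #> x)"
    using assms unfolding r_coset_def by (force intro!: image_eqI[of _ _ "\<one> \<otimes> x"])
qed

section \<open>The balanced tensor product as an abelian group generated by pure tensors\<close>

locale balanced_tensor =
  G: comm_group G + H: comm_group H
  for G :: "('g, 'a) monoid_scheme" (structure) and H :: "('h, 'b) monoid_scheme" (structure)
    and S :: "'s set" and act_r :: "'g \<Rightarrow> 's \<Rightarrow> 'g" and act_l :: "'s \<Rightarrow> 'h \<Rightarrow> 'h" +
  assumes act_r_closed: "x \<in> carrier G \<Longrightarrow> s \<in> S \<Longrightarrow> act_r x s \<in> carrier G"
    and act_l_closed: "y \<in> carrier H \<Longrightarrow> s \<in> S \<Longrightarrow> act_l s y \<in> carrier H"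
begin

abbreviation F where "F \<equiv> free_Abelian_group (carrier G \<times> carrier H)"
abbreviation T where "T \<equiv> tensor_product G H S act_r act_l"
abbreviation C where "C \<equiv> tensor_kernel G H S act_r act_l"
abbreviation pure where "pure \<equiv> pure_tensor G H S act_r act_l"
abbreviation Rel where "Rel \<equiv> tensor_relations G H S act_r act_l"

definition balanced :: "('k, 'c) monoid_scheme \<Rightarrow> ('g \<Rightarrow> 'h \<Rightarrow> 'k) \<Rightarrow> bool" where
  "balanced K f \<longleftrightarrow>
     (\<forall>x\<in>carrier G. \<forall>y\<in>carrier H. f x y \<in> carrier K) \<and>
     (\<forall>x\<in>carrier G. \<forall>x'\<in>carrier G. \<forall>y\<in>carrier H. f (x \<otimes>\<^bsub>G\<^esub> x') y = f x y \<otimes>\<^bsub>K\<^esub> f x' y) \<and>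
     (\<forall>x\<in>carrier G. \<forall>y\<in>carrier H. \<forall>y'\<in>carrier H. f x (y \<otimes>\<^bsub>H\<^esub> y') = f x y \<otimes>\<^bsub>K\<^esub> f x y') \<and>
     (\<forall>x\<in>carrier G. \<forall>s\<in>S. \<forall>y\<in>carrier H. f (act_r x s) y = f x (act_l s y))"

lemma balancedI:
  assumes "\<And>x y. x \<in> carrier G \<Longrightarrow> y \<in> carrier H \<Longrightarrow> f x y \<in> carrier K"
    and "\<And>x x' y. x \<in> carrier G \<Longrightarrow> x' \<in> carrier G \<Longrightarrow> y \<in> carrier H \<Longrightarrow>
      f (x \<otimes>\<^bsub>G\<^esub> x') y = f x y \<otimes>\<^bsub>K\<^esub> f x' y"
    and "\<And>x y y'. x \<in> carrier G \<Longrightarrow> y \<in> carrier H \<Longrightarrow> y' \<in> carrier H \<Longrightarrow>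
      f x (y \<otimes>\<^bsub>H\<^esub> y') = f x y \<otimes>\<^bsub>K\<^esub> f x y'"
    and "\<And>x s y. x \<in> carrier G \<Longrightarrow> s \<in> S \<Longrightarrow> y \<in> carrier H \<Longrightarrow> f (act_r x s) y = f x (act_l s y)"
  shows "balanced K f"
  using assms by (simp add: balanced_def)

text \<open>Closure under the two actions places the balancing relations in the free group on pairs
  of carrier elements.\<close>

lemma Rel_subset: "Rel \<subseteq> carrier F"
proof -
  have *: "frag_of p - frag_of q \<in> carrier F" if "p \<in> carrier G \<times> carrier H" "q \<in> carrier G \<times> carrier H" for p q
    using that keys_diff[of "frag_of p" "frag_of q"] by auto
  have **: "frag_of p - frag_of q - frag_of r \<in> carrier F"
    if "p \<in> carrier G \<times> carrier H" "q \<in> carrier G \<times> carrier H" "r \<in> carrier G \<times> carrier H" for p q r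
    using *[OF that(1,2)] that(3) keys_diff[of "frag_of p - frag_of q" "frag_of r"] by auto
  show ?thesis
    unfolding tensor_relations_def
    using act_r_closed act_l_closed by (auto intro!: * ** simp del: carrier_free_Abelian_group_iff)
qed

lemma C_subgroup: "subgroup C F"
  unfolding tensor_kernel_def by (rule group.generate_is_subgroup) (use Rel_subset in auto)

lemma C_normal: "C \<lhd> F"
  using C_subgroup abelian_free_Abelian_group comm_group.subgroup_imp_normal by blast

lemma T_comm_group: "comm_group T"
  unfolding tensor_product_def
  by (rule comm_group.abelian_FactGroup[OF abelian_free_Abelian_group C_subgroup])

lemma coset_hom: "(\<lambda>z. C #>\<^bsub>F\<^esub> z) \<in> hom F T"
  unfolding tensor_product_def by (rule normal.r_coset_hom_Mod[OF C_normal])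

sublocale T: comm_group T
  by (rule T_comm_group)

sublocale coset: group_hom F T "\<lambda>z. C #>\<^bsub>F\<^esub> z"
  by (simp add: group_hom_def group_hom_axioms_def coset_hom)

lemma pure_closed [simp]: "x \<in> carrier G \<Longrightarrow> y \<in> carrier H \<Longrightarrow> pure x y \<in> carrier T"
  unfolding pure_tensor_def by (rule coset.hom_closed) simp

text \<open>A relation is a generator of \<open>C\<close> and so vanishes in the quotient. As every
  relation is written as a difference, the laws for \<open>pure\<close> below only require naming
  the matching one.\<close>

lemma coset_eqI:
  assumes "x - y \<in> Rel" "x \<in> carrier F" "y \<in> carrier F"
  shows "C #>\<^bsub>F\<^esub> x = C #>\<^bsub>F\<^esub> y"
proof -
  have "x - y \<in> C"
    unfolding tensor_kernel_def using assms(1) by (rule generate.incl)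
  then have "(x - y) + y \<in> C #>\<^bsub>F\<^esub> y"
    unfolding r_coset_def by force
  then show ?thesis
    using group.repr_independence[OF _ _ assms(3) C_subgroup] by simp
qed

lemma keys_frag_add:
  assumes "p \<in> P" "q \<in> P" shows "Poly_Mapping.keys (frag_of p + frag_of q) \<subseteq> P"
  using keys_add[of "frag_of p" "frag_of q"] assms by auto

lemma pure_add_left:
  assumes "x \<in> carrier G" "x' \<in> carrier G" "y \<in> carrier H"
  shows "pure (x \<otimes>\<^bsub>G\<^esub> x') y = pure x y \<otimes>\<^bsub>T\<^esub> pure x' y"
proof -
  have "C #>\<^bsub>F\<^esub> frag_of (x \<otimes>\<^bsub>G\<^esub> x', y) = C #>\<^bsub>F\<^esub> (frag_of (x, y) \<otimes>\<^bsub>F\<^esub> frag_of (x', y))"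
  proof (rule coset_eqI)
    show "frag_of (x \<otimes>\<^bsub>G\<^esub> x', y) - (frag_of (x, y) \<otimes>\<^bsub>F\<^esub> frag_of (x', y)) \<in> Rel"
      unfolding mult_free_Abelian_group diff_diff_add[symmetric] tensor_relations_def
      using assms by blast
  qed (use assms in \<open>simp_all add: keys_frag_add\<close>)
  also have "\<dots> = pure x y \<otimes>\<^bsub>T\<^esub> pure x' y"
    unfolding pure_tensor_def by (rule coset.hom_mult) (use assms in auto)
  finally show ?thesis unfolding pure_tensor_def .
qed

lemma pure_add_right:
  assumes "x \<in> carrier G" "y \<in> carrier H" "y' \<in> carrier H"
  shows "pure x (y \<otimes>\<^bsub>H\<^esub> y') = pure x y \<otimes>\<^bsub>T\<^esub> pure x y'"
proof -
  have "C #>\<^bsub>F\<^esub> frag_of (x, y \<otimes>\<^bsub>H\<^esub> y') = C #>\<^bsub>F\<^esub> (frag_of (x, y) \<otimes>\<^bsub>F\<^esub> frag_of (x, y'))"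
  proof (rule coset_eqI)
    show "frag_of (x, y \<otimes>\<^bsub>H\<^esub> y') - (frag_of (x, y) \<otimes>\<^bsub>F\<^esub> frag_of (x, y')) \<in> Rel"
      unfolding mult_free_Abelian_group diff_diff_add[symmetric] tensor_relations_def
      using assms by blast
  qed (use assms in \<open>simp_all add: keys_frag_add\<close>)
  also have "\<dots> = pure x y \<otimes>\<^bsub>T\<^esub> pure x y'"
    unfolding pure_tensor_def by (rule coset.hom_mult) (use assms in auto)
  finally show ?thesis unfolding pure_tensor_def .
qed

lemma pure_act:
  assumes "x \<in> carrier G" "s \<in> S" "y \<in> carrier H"
  shows "pure (act_r x s) y = pure x (act_l s y)"
  unfolding pure_tensor_def
proof (rule coset_eqI)
  show "frag_of (act_r x s, y) - frag_of (x, act_l s y) \<in> Rel"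
    unfolding tensor_relations_def using assms by blast
qed (use assms act_r_closed act_l_closed in simp_all)

text \<open>By additivity this element is its own square, and the only idempotent of a group is its
  identity.\<close>

lemma pure_one_left: "y \<in> carrier H \<Longrightarrow> pure \<one>\<^bsub>G\<^esub> y = \<one>\<^bsub>T\<^esub>"
  using pure_add_left[of "\<one>\<^bsub>G\<^esub>" "\<one>\<^bsub>G\<^esub>" y] by simp

lemma inv_pure:
  assumes "x \<in> carrier G" "y \<in> carrier H"
  shows "inv\<^bsub>T\<^esub> (pure x y) = pure (inv\<^bsub>G\<^esub> x) y"
  using assms pure_add_left[of "inv\<^bsub>G\<^esub> x" x y]
  by (intro T.inv_equality) (simp_all add: pure_one_left)

text \<open>Inverses need no case of their own: the inverse of a pure tensor is again pure by
  \<open>inv_pure\<close>, so pure tensors generate \<open>T\<close> already under products.\<close>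

lemma tensor_induct [consumes 1, case_names pure mult]:
  assumes X: "X \<in> carrier T"
    and p: "\<And>x y. x \<in> carrier G \<Longrightarrow> y \<in> carrier H \<Longrightarrow> P (pure x y)"
    and m: "\<And>X Y. X \<in> carrier T \<Longrightarrow> Y \<in> carrier T \<Longrightarrow> P X \<Longrightarrow> P Y \<Longrightarrow> P (X \<otimes>\<^bsub>T\<^esub> Y)"
  shows "P X"
proof -
  obtain z where z: "Poly_Mapping.keys z \<subseteq> carrier G \<times> carrier H" "X = C #>\<^bsub>F\<^esub> z"
    using X unfolding tensor_product_def by (auto simp: carrier_FactGroup)
  \<comment> \<open>Induction on the free abelian group proceeds by differences, and the class of x
    - y involves the inverse of the class of y. Carrying \<open>P\<close> for the inverse as well
    closes the induction.\<close>
  have "P (C #>\<^bsub>F\<^esub> z) \<and> P (inv\<^bsub>T\<^esub> (C #>\<^bsub>F\<^esub> z))"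
    using z(1)
  proof (induction z rule: free_Abelian_group_induct[consumes 1, case_names zero diff frag])
    case zero
    have "P (pure \<one>\<^bsub>G\<^esub> \<one>\<^bsub>H\<^esub>)" by (rule p) auto
    moreover have "C #>\<^bsub>F\<^esub> 0 = \<one>\<^bsub>T\<^esub>" using coset.hom_one by simp
    ultimately show ?case by (simp add: pure_one_left)
  next
    case (diff x y)
    let ?q = "\<lambda>z. C #>\<^bsub>F\<^esub> z"
    have c: "?q x \<in> carrier T" "?q y \<in> carrier T"
      using diff coset.hom_closed by auto
    have "?q (x - y) = ?q (x \<otimes>\<^bsub>F\<^esub> inv\<^bsub>F\<^esub> y)" using diff by simp
    also have "\<dots> = ?q x \<otimes>\<^bsub>T\<^esub> inv\<^bsub>T\<^esub> ?q y"
      using diff by (metis carrier_free_Abelian_group_iff coset.hom_inv coset.hom_mult group.inv_closed[OF group_free_Abelian_group])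
    finally have e: "?q (x - y) = ?q x \<otimes>\<^bsub>T\<^esub> inv\<^bsub>T\<^esub> ?q y" .
    moreover have "inv\<^bsub>T\<^esub> (?q x \<otimes>\<^bsub>T\<^esub> inv\<^bsub>T\<^esub> ?q y) = ?q y \<otimes>\<^bsub>T\<^esub> inv\<^bsub>T\<^esub> ?q x"
      using c by (simp add: T.inv_mult_group)
    ultimately show ?case using m c diff by simp
  next
    case (frag a)
    then obtain x y where a: "a = (x, y)" "x \<in> carrier G" "y \<in> carrier H" by auto
    have e: "C #>\<^bsub>F\<^esub> frag_of a = pure x y" by (simp add: a pure_tensor_def)
    show ?case unfolding e using a p by (simp add: inv_pure)
  qed
  then show ?thesis using z by simp
qed

lemma tensor_hom_eqI:
  assumes "X \<in> carrier T" "g \<in> hom T K" "h \<in> hom T K"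
    and "\<And>x y. x \<in> carrier G \<Longrightarrow> y \<in> carrier H \<Longrightarrow> g (pure x y) = h (pure x y)"
  shows "g X = h X"
  using assms(1) by (induction rule: tensor_induct) (simp_all add: assms(4) hom_mult[OF assms(2)] hom_mult[OF assms(3)])

section \<open>Homomorphisms induced by balanced maps\<close>

context
  fixes K :: "('k, 'c) monoid_scheme" and f
  assumes K: "comm_group K" and f: "balanced K f"
begin

private abbreviation ext where
  "ext \<equiv> frag_extend K (\<lambda>p. f (fst p) (snd p))"

interpretation K: comm_group K by (rule K)

lemma ext_hom: "ext \<in> hom F K"
  by (rule K.frag_extend_hom) (use f in \<open>auto simp: balanced_def\<close>)

interpretation ext: group_hom F K ext
  using ext_hom by (simp add: group_hom_def group_hom_axioms_def K.group_axioms)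

lemma ext_frag_of:
  "x \<in> carrier G \<Longrightarrow> y \<in> carrier H \<Longrightarrow> ext (frag_of (x, y)) = f x y"
  using f by (simp add: balanced_def K.frag_extend_frag_of)

lemma ext_diff:
  assumes "x \<in> carrier F" "y \<in> carrier F"
  shows "ext (x - y) = ext x \<otimes>\<^bsub>K\<^esub> inv\<^bsub>K\<^esub> (ext y)"
proof -
  have y: "inv\<^bsub>F\<^esub> y \<in> carrier F"
    using assms(2) by (rule group.inv_closed[OF group_free_Abelian_group])
  have "ext (x \<otimes>\<^bsub>F\<^esub> inv\<^bsub>F\<^esub> y) = ext x \<otimes>\<^bsub>K\<^esub> inv\<^bsub>K\<^esub> (ext y)"
    unfolding ext.hom_mult[OF assms(1) y] ext.hom_inv[OF assms(2)] ..
  then show ?thesis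
    using assms by simp
qed

text \<open>Each kind of relation corresponds to one clause of \<open>balanced\<close>, so
  \<open>ext\<close> kills it. The kernel is a subgroup and therefore contains everything the
  relations generate.\<close>

lemma C_subset_kernel: "C \<subseteq> kernel F K ext"
proof -
  have fc: "f x y \<in> carrier K" if "x \<in> carrier G" "y \<in> carrier H" for x y
    using f that by (simp add: balanced_def)
  \<comment> \<open>Balancing relations have two terms and additivity relations have three; the
    facts \<open>2\<close> and \<open>3\<close> treat these two shapes.\<close>
  have 2: "ext (frag_of p - frag_of q) = \<one>\<^bsub>K\<^esub>"
    if "f (fst p) (snd p) = f (fst q) (snd q)" "p \<in> carrier G \<times> carrier H" "q \<in> carrier G \<times> carrier H" for p q
    using that fc by (subst ext_diff) (auto simp: ext_frag_of)
  have 3: "ext (frag_of p - frag_of q - frag_of r) = \<one>\<^bsub>K\<^esub>"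
    if "f (fst p) (snd p) = f (fst q) (snd q) \<otimes>\<^bsub>K\<^esub> f (fst r) (snd r)"
      "p \<in> carrier G \<times> carrier H" "q \<in> carrier G \<times> carrier H" "r \<in> carrier G \<times> carrier H" for p q r
  proof -
    have c: "frag_of q + frag_of r \<in> carrier F" using that keys_frag_add by simp
    have "frag_of p - frag_of q - frag_of r = frag_of p - (frag_of q \<otimes>\<^bsub>F\<^esub> frag_of r)" by simp
    also have "ext \<dots> = ext (frag_of p) \<otimes>\<^bsub>K\<^esub> inv\<^bsub>K\<^esub> (ext (frag_of q) \<otimes>\<^bsub>K\<^esub> ext (frag_of r))"
      using that c by (subst ext_diff, simp, simp, subst ext.hom_mult) simp_all
    finally show ?thesis using that fc by (auto simp: ext_frag_of)
  qed
  have "Rel \<subseteq> kernel F K ext"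
  proof
    fix z assume z: "z \<in> Rel"
    then consider
      (left) x x' y where "z = frag_of (x \<otimes>\<^bsub>G\<^esub> x', y) - frag_of (x, y) - frag_of (x', y)"
        "x \<in> carrier G" "x' \<in> carrier G" "y \<in> carrier H" |
      (right) x y y' where "z = frag_of (x, y \<otimes>\<^bsub>H\<^esub> y') - frag_of (x, y) - frag_of (x, y')"
        "x \<in> carrier G" "y \<in> carrier H" "y' \<in> carrier H" |
      (act) x s y where "z = frag_of (act_r x s, y) - frag_of (x, act_l s y)"
        "x \<in> carrier G" "s \<in> S" "y \<in> carrier H"
      unfolding tensor_relations_def by blast
    then have "ext z = \<one>\<^bsub>K\<^esub>"
    proof cases
      case left
      show ?thesis
        unfolding left(1) by (rule 3) (use left(2-) f in \<open>simp_all add: balanced_def\<close>)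
    next
      case right
      show ?thesis
        unfolding right(1) by (rule 3) (use right(2-) f in \<open>simp_all add: balanced_def\<close>)
    next
      case act
      show ?thesis
        unfolding act(1) by (rule 2) (use act(2-) f act_r_closed act_l_closed in \<open>simp_all add: balanced_def\<close>)
    qed
    then show "z \<in> kernel F K ext" using z Rel_subset unfolding kernel_def by blast
  qed
  then show ?thesis
    unfolding tensor_kernel_def
    by (rule group.generate_subgroup_incl[OF group_free_Abelian_group _ ext.subgroup_kernel])
qed

text \<open>As \<open>C\<close> lies in the kernel of \<open>ext\<close>, the image of a coset is a
  singleton, and the \<open>the_elem\<close> in \<open>tensor_lift\<close> returns the value at any
  representative.\<close>

lemma tensor_lift_coset: "z \<in> carrier F \<Longrightarrow> tensor_lift K f (C #>\<^bsub>F\<^esub> z) = ext z"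
  unfolding tensor_lift_eq
  by (subst ext.constant_on_kernel_coset[OF C_subset_kernel])
    (use subgroup.one_closed[OF C_subgroup] in auto)

lemma tensor_lift_pure:
  "x \<in> carrier G \<Longrightarrow> y \<in> carrier H \<Longrightarrow> tensor_lift K f (pure x y) = f x y"
  unfolding pure_tensor_def by (subst tensor_lift_coset) (auto simp: ext_frag_of)

lemma tensor_lift_hom: "tensor_lift K f \<in> hom T K"
proof (rule homI)
  fix X assume "X \<in> carrier T"
  then obtain x where "x \<in> carrier F" "X = C #>\<^bsub>F\<^esub> x"
    unfolding tensor_product_def by (auto simp: carrier_FactGroup)
  then show "tensor_lift K f X \<in> carrier K"
    using tensor_lift_coset ext.hom_closed by simp
next
  fix X Y assume "X \<in> carrier T" "Y \<in> carrier T"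
  then obtain x y where x: "x \<in> carrier F" "X = C #>\<^bsub>F\<^esub> x" and y: "y \<in> carrier F" "Y = C #>\<^bsub>F\<^esub> y"
    unfolding tensor_product_def carrier_FactGroup by blast
  have "X \<otimes>\<^bsub>T\<^esub> Y = C #>\<^bsub>F\<^esub> (x \<otimes>\<^bsub>F\<^esub> y)"
    unfolding x(2) y(2) by (rule coset.hom_mult[OF x(1) y(1), symmetric])
  moreover have "x \<otimes>\<^bsub>F\<^esub> y \<in> carrier F"
    by (rule monoid.m_closed[OF group.is_monoid[OF group_free_Abelian_group] x(1) y(1)])
  ultimately show "tensor_lift K f (X \<otimes>\<^bsub>T\<^esub> Y) = tensor_lift K f X \<otimes>\<^bsub>K\<^esub> tensor_lift K f Y"
    unfolding x(2) y(2) by (simp only: tensor_lift_coset x(1) y(1) ext.hom_mult)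
qed

lemma tensor_lift_closed: "X \<in> carrier T \<Longrightarrow> tensor_lift K f X \<in> carrier K"
  by (rule hom_in_carrier[OF tensor_lift_hom])

end

end

text \<open>This covers every index set: over an infinite one \<open>finprod\<close> has the default
  value 1, which a group homomorphism preserves.\<close>

lemma hom_finprod_comm:
  assumes "comm_group G" "comm_group H" "h \<in> hom G H" "f \<in> A \<rightarrow> carrier G"
  shows "h (finprod G f A) = finprod H (\<lambda>i. h (f i)) A"
proof -
  interpret G: comm_group G by fact
  interpret H: comm_group H by fact
  interpret h: group_hom G H h
    by (simp add: group_hom_def group_hom_axioms_def G.group_axioms H.group_axioms assms)
  show ?thesis
    using assms(4) by (induction A rule: infinite_finite_induct) (auto simp: Pi_iff)
qed

section \<open>Rings of additive endomorphisms\<close>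

lemma carrier_endo_ring_on [simp]: "carrier (endo_ring_on M E) = E"
  and mult_endo_ring_on [simp]: "monoid.mult (endo_ring_on M E) = compose (carrier M)"
  and one_endo_ring_on [simp]: "\<one>\<^bsub>endo_ring_on M E\<^esub> = (\<lambda>x\<in>carrier M. x)"
  and zero_endo_ring_on [simp]: "\<zero>\<^bsub>endo_ring_on M E\<^esub> = (\<lambda>x\<in>carrier M. \<zero>\<^bsub>M\<^esub>)"
  and add_endo_ring_on [simp]: "f \<oplus>\<^bsub>endo_ring_on M E\<^esub> g = (\<lambda>x\<in>carrier M. f x \<oplus>\<^bsub>M\<^esub> g x)"
  by (simp_all add: endo_ring_on_def)

text \<open>Serves both \<open>End_right\<close> and \<open>End_bimod\<close>, which differ only in
  the set of additive maps. Additivity of the maps is what gives h (f + g) = h f + h g.\<close>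

lemma (in ring) ring_endo_ring_on:
  assumes E: "E \<subseteq> hom (add_monoid R) (add_monoid R) \<inter> extensional (carrier R)"
    and add: "\<And>f g. f \<in> E \<Longrightarrow> g \<in> E \<Longrightarrow> (\<lambda>x\<in>carrier R. f x \<oplus> g x) \<in> E"
    and zero: "(\<lambda>x\<in>carrier R. \<zero>) \<in> E"
    and neg: "\<And>f. f \<in> E \<Longrightarrow> (\<lambda>x\<in>carrier R. \<ominus> f x) \<in> E"
    and one: "(\<lambda>x\<in>carrier R. x) \<in> E"
    and comp: "\<And>f g. f \<in> E \<Longrightarrow> g \<in> E \<Longrightarrow> compose (carrier R) f g \<in> E"
  shows "ring (endo_ring_on R E)"
proof -
  have ext: "f = g" if "f \<in> E" "g \<in> E" "\<And>x. x \<in> carrier R \<Longrightarrow> f x = g x" for f g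
    using that E extensionalityI[of f "carrier R" g] by blast
  have cl: "f x \<in> carrier R" if "f \<in> E" "x \<in> carrier R" for f x
    using that E by (auto simp: hom_def)
  have fadd: "f (x \<oplus> y) = f x \<oplus> f y" if "f \<in> E" "x \<in> carrier R" "y \<in> carrier R" for f x y
    using that E by (auto simp: hom_def)
  let ?S = "endo_ring_on R E"
  have closed: "f \<oplus>\<^bsub>?S\<^esub> g \<in> E" "f \<otimes>\<^bsub>?S\<^esub> g \<in> E" if "f \<in> E" "g \<in> E" for f g
    using that add comp by simp_all
  have const: "\<zero>\<^bsub>?S\<^esub> \<in> E" "\<one>\<^bsub>?S\<^esub> \<in> E"
    using zero one by simp_all
  have vals: "(f \<oplus>\<^bsub>?S\<^esub> g) x = f x \<oplus> g x" "(f \<otimes>\<^bsub>?S\<^esub> g) x = f (g x)"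
    "\<zero>\<^bsub>?S\<^esub> x = \<zero>" "\<one>\<^bsub>?S\<^esub> x = x" if "x \<in> carrier R" for f g x
    using that by (simp_all add: compose_eq)
  \<comment> \<open>The operations stay folded: \<open>ext\<close> reduces each ring law to an
    identity at a point, and \<open>vals\<close> evaluates both sides there.\<close>
  note [simp del] = add_endo_ring_on mult_endo_ring_on one_endo_ring_on zero_endo_ring_on
  note rules = closed const vals
  show ?thesis
  proof (rule ringI)
    show "abelian_group ?S"
    proof (rule abelian_groupI)
      fix f g h assume "f \<in> carrier ?S" "g \<in> carrier ?S" "h \<in> carrier ?S"
      then have E: "f \<in> E" "g \<in> E" "h \<in> E" by simp_all
      note E = E E[THEN cl]
      show "f \<oplus>\<^bsub>?S\<^esub> g \<oplus>\<^bsub>?S\<^esub> h = f \<oplus>\<^bsub>?S\<^esub> (g \<oplus>\<^bsub>?S\<^esub> h)"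
        by (rule ext) (simp_all add: rules E a_assoc)
      show "f \<oplus>\<^bsub>?S\<^esub> g = g \<oplus>\<^bsub>?S\<^esub> f"
        by (rule ext) (simp_all add: rules E a_comm)
      show "\<zero>\<^bsub>?S\<^esub> \<oplus>\<^bsub>?S\<^esub> f = f"
        by (rule ext) (simp_all add: rules E)
      have "(\<lambda>x\<in>carrier R. \<ominus> f x) \<oplus>\<^bsub>?S\<^esub> f = \<zero>\<^bsub>?S\<^esub>"
        by (rule ext) (simp_all add: rules E neg l_neg)
      then show "\<exists>g\<in>carrier ?S. g \<oplus>\<^bsub>?S\<^esub> f = \<zero>\<^bsub>?S\<^esub>"
        using neg[OF E(1)] by auto
    qed (simp_all add: rules)
    show "monoid ?S"
    proof (rule monoidI)
      fix f g h assume "f \<in> carrier ?S" "g \<in> carrier ?S" "h \<in> carrier ?S"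
      then have E: "f \<in> E" "g \<in> E" "h \<in> E" by simp_all
      note E = E E[THEN cl]
      show "f \<otimes>\<^bsub>?S\<^esub> g \<otimes>\<^bsub>?S\<^esub> h = f \<otimes>\<^bsub>?S\<^esub> (g \<otimes>\<^bsub>?S\<^esub> h)"
        by (rule ext) (simp_all add: rules E)
      show "\<one>\<^bsub>?S\<^esub> \<otimes>\<^bsub>?S\<^esub> f = f" "f \<otimes>\<^bsub>?S\<^esub> \<one>\<^bsub>?S\<^esub> = f"
        by (rule ext; simp add: rules E)+
    qed (simp_all add: rules)
    fix f g h assume "f \<in> carrier ?S" "g \<in> carrier ?S" "h \<in> carrier ?S"
    then have E: "f \<in> E" "g \<in> E" "h \<in> E" by simp_all
    note E = E E[THEN cl]
    show "(f \<oplus>\<^bsub>?S\<^esub> g) \<otimes>\<^bsub>?S\<^esub> h = f \<otimes>\<^bsub>?S\<^esub> h \<oplus>\<^bsub>?S\<^esub> g \<otimes>\<^bsub>?S\<^esub> h"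
      by (rule ext) (simp_all add: rules E)
    show "h \<otimes>\<^bsub>?S\<^esub> (f \<oplus>\<^bsub>?S\<^esub> g) = h \<otimes>\<^bsub>?S\<^esub> f \<oplus>\<^bsub>?S\<^esub> h \<otimes>\<^bsub>?S\<^esub> g"
      by (rule ext) (simp_all add: rules E fadd)
  qed
qed

section \<open>Right linear maps and the two endomorphism rings of an extension\<close>

locale ring_extension = M: ring M + N: ring N
  for M :: "('m, 'a) ring_scheme" (structure) and N :: "('n, 'b) ring_scheme" +
  fixes phi :: "'n \<Rightarrow> 'm"
  assumes phi_hom: "phi \<in> ring_hom N M"
begin

abbreviation E where "E \<equiv> End_right M N phi"
abbreviation A where "A \<equiv> End_bimod M N phi"
abbreviation R where "R \<equiv> ext_centralizer M N phi"
abbreviation MMT where "MMT \<equiv> MM_tensor M N phi"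
abbreviation MAT where "MAT \<equiv> MA_tensor M N phi"
abbreviation AAT where "AAT \<equiv> AA_tensor M N phi"
abbreviation mm where "mm \<equiv> MM_pure M N phi"
abbreviation aa where "aa \<equiv> AA_pure M N phi"
abbreviation ma where "ma \<equiv> smash M N phi"

lemma phi_closed [simp]: "n \<in> carrier N \<Longrightarrow> phi n \<in> carrier M"
  using phi_hom by (rule ring_hom_closed)

text \<open>Constrains a function only on \<open>carrier M\<close> and asks for no extensionality.
  Plain lambda terms can thus be used as they stand, and \<open>EI\<close> restricts them to
  elements of \<open>E\<close> when required.\<close>

definition right_linear :: "('m \<Rightarrow> 'm) \<Rightarrow> bool" where
  "right_linear f \<longleftrightarrow>
     (\<forall>x\<in>carrier M. f x \<in> carrier M) \<and>
     (\<forall>x\<in>carrier M. \<forall>y\<in>carrier M. f (x \<oplus>\<^bsub>M\<^esub> y) = f x \<oplus>\<^bsub>M\<^esub> f y) \<and>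
     (\<forall>x\<in>carrier M. \<forall>n\<in>carrier N. f (x \<otimes>\<^bsub>M\<^esub> phi n) = f x \<otimes>\<^bsub>M\<^esub> phi n)"

lemma right_linearD:
  assumes "right_linear f"
  shows "x \<in> carrier M \<Longrightarrow> f x \<in> carrier M"
    and "x \<in> carrier M \<Longrightarrow> y \<in> carrier M \<Longrightarrow> f (x \<oplus>\<^bsub>M\<^esub> y) = f x \<oplus>\<^bsub>M\<^esub> f y"
    and "x \<in> carrier M \<Longrightarrow> n \<in> carrier N \<Longrightarrow> f (x \<otimes>\<^bsub>M\<^esub> phi n) = f x \<otimes>\<^bsub>M\<^esub> phi n"
  using assms by (auto simp: right_linear_def)

lemma right_linear_comp_mult:
  assumes "right_linear f" "m \<in> carrier M"
  shows "right_linear (\<lambda>x. f (m \<otimes>\<^bsub>M\<^esub> x))"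
  using assms unfolding right_linear_def by (simp add: M.r_distr flip: M.m_assoc)

lemma right_linear_mult:
  assumes "right_linear f" "m \<in> carrier M"
  shows "right_linear (\<lambda>x. m \<otimes>\<^bsub>M\<^esub> f x)"
  using assms unfolding right_linear_def by (simp add: M.r_distr M.m_assoc)

lemma right_linear_add:
  assumes "right_linear f" "right_linear g"
  shows "right_linear (\<lambda>x. f x \<oplus>\<^bsub>M\<^esub> g x)"
  using assms unfolding right_linear_def by (simp add: M.l_distr M.a_ac)

lemma right_linear_cong:
  assumes "right_linear f" "\<And>x. x \<in> carrier M \<Longrightarrow> g x = f x"
  shows "right_linear g"
  using assms unfolding right_linear_def by simp

lemma E_iff: "f \<in> carrier E \<longleftrightarrow> f \<in> extensional (carrier M) \<and> right_linear f"
  by (auto simp: End_right_def End_right_carrier_def right_linear_def hom_def)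

lemma A_iff:
  "f \<in> carrier A \<longleftrightarrow> f \<in> carrier E \<and>
     (\<forall>n\<in>carrier N. \<forall>x\<in>carrier M. f (phi n \<otimes>\<^bsub>M\<^esub> x) = phi n \<otimes>\<^bsub>M\<^esub> f x)"
  by (auto simp: End_right_def End_bimod_def End_bimod_carrier_def)

lemma EI: "right_linear f \<Longrightarrow> (\<lambda>x\<in>carrier M. f x) \<in> carrier E"
  unfolding E_iff by (auto intro: right_linear_cong)

lemma AI:
  assumes "right_linear f"
    and "\<And>n x. n \<in> carrier N \<Longrightarrow> x \<in> carrier M \<Longrightarrow> f (phi n \<otimes>\<^bsub>M\<^esub> x) = phi n \<otimes>\<^bsub>M\<^esub> f x"
  shows "(\<lambda>x\<in>carrier M. f x) \<in> carrier A"
  unfolding A_iff using EI[OF assms(1)] assms(2) by simp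

lemma E_right_linear: "f \<in> carrier E \<Longrightarrow> right_linear f"
  by (simp add: E_iff)

lemma A_subset_E: "f \<in> carrier A \<Longrightarrow> f \<in> carrier E"
  by (simp add: A_iff)

lemma A_right_linear: "f \<in> carrier A \<Longrightarrow> right_linear f"
  by (simp add: A_iff E_iff)

lemma A_left: "f \<in> carrier A \<Longrightarrow> n \<in> carrier N \<Longrightarrow> x \<in> carrier M \<Longrightarrow> f (phi n \<otimes>\<^bsub>M\<^esub> x) = phi n \<otimes>\<^bsub>M\<^esub> f x"
  by (simp add: A_iff)

lemma E_closed: "f \<in> carrier E \<Longrightarrow> x \<in> carrier M \<Longrightarrow> f x \<in> carrier M"
  by (simp add: E_iff right_linearD)

lemma A_closed: "f \<in> carrier A \<Longrightarrow> x \<in> carrier M \<Longrightarrow> f x \<in> carrier M"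
  by (rule E_closed[OF A_subset_E])

lemma E_eqI:
  assumes "f \<in> carrier E" "g \<in> carrier E" "\<And>x. x \<in> carrier M \<Longrightarrow> f x = g x"
  shows "f = g"
  using assms extensionalityI[of f "carrier M" g] unfolding E_iff by blast

lemma right_linear_zero: "right_linear (\<lambda>x. \<zero>\<^bsub>M\<^esub>)"
  and right_linear_id: "right_linear (\<lambda>x. x)"
  by (simp_all add: right_linear_def)

lemma right_linear_neg: "right_linear f \<Longrightarrow> right_linear (\<lambda>x. \<ominus>\<^bsub>M\<^esub> f x)"
  by (simp add: right_linear_def M.minus_add M.l_minus)

lemma right_linear_compose: "right_linear f \<Longrightarrow> right_linear g \<Longrightarrow> right_linear (\<lambda>x. f (g x))"
  by (simp add: right_linear_def)

lemma ring_E: "ring E"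
proof -
  have E: "carrier E = End_right_carrier M N phi" by (simp add: End_right_def)
  show ?thesis
    unfolding End_right_def
  proof (rule M.ring_endo_ring_on; (unfold compose_def)?; (fold E)?)
    show "carrier E \<subseteq> hom (add_monoid M) (add_monoid M) \<inter> extensional (carrier M)"
      by (auto simp: E End_right_carrier_def)
    show "(\<lambda>x\<in>carrier M. f (g x)) \<in> carrier E" if "f \<in> carrier E" "g \<in> carrier E" for f g
      using that by (intro EI right_linear_compose[of f g]) (simp_all add: E_right_linear)
    show "(\<lambda>x\<in>carrier M. f x \<oplus>\<^bsub>M\<^esub> g x) \<in> carrier E" if "f \<in> carrier E" "g \<in> carrier E" for f g
      using that by (intro EI right_linear_add) (simp_all add: E_right_linear)
    show "(\<lambda>x\<in>carrier M. \<ominus>\<^bsub>M\<^esub> f x) \<in> carrier E" if "f \<in> carrier E" for f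
      using that by (intro EI right_linear_neg) (simp add: E_right_linear)
  qed (rule EI[OF right_linear_zero] EI[OF right_linear_id])+
qed

lemma ring_A: "ring A"
proof -
  have A: "carrier A = End_bimod_carrier M N phi" by (simp add: End_bimod_def)
  show ?thesis
    unfolding End_bimod_def
  proof (rule M.ring_endo_ring_on; (unfold compose_def)?; (fold A)?)
    show "carrier A \<subseteq> hom (add_monoid M) (add_monoid M) \<inter> extensional (carrier M)"
      by (auto simp: A End_bimod_carrier_def End_right_carrier_def)
    show "(\<lambda>x\<in>carrier M. f x \<oplus>\<^bsub>M\<^esub> g x) \<in> carrier A" if "f \<in> carrier A" "g \<in> carrier A" for f g
      using that by (intro AI right_linear_add) (auto simp: A_right_linear A_left A_closed M.r_distr)
    show "(\<lambda>x\<in>carrier M. \<zero>\<^bsub>M\<^esub>) \<in> carrier A"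
      by (intro AI right_linear_zero) simp
    show "(\<lambda>x\<in>carrier M. \<ominus>\<^bsub>M\<^esub> f x) \<in> carrier A" if "f \<in> carrier A" for f
      using that by (intro AI right_linear_neg) (auto simp: A_right_linear A_left A_closed M.r_minus)
    show "(\<lambda>x\<in>carrier M. x) \<in> carrier A"
      by (intro AI right_linear_id) simp
    show "(\<lambda>x\<in>carrier M. f (g x)) \<in> carrier A" if "f \<in> carrier A" "g \<in> carrier A" for f g
      using that by (intro AI right_linear_compose[of f g]) (auto simp: A_right_linear A_left A_closed)
  qed
qed

sublocale E: ring E by (rule ring_E)
sublocale A: ring A by (rule ring_A)

lemma E_mult: "f \<otimes>\<^bsub>E\<^esub> g = (\<lambda>x\<in>carrier M. f (g x))"
  and E_one: "\<one>\<^bsub>E\<^esub> = (\<lambda>x\<in>carrier M. x)"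
  and E_add: "f \<oplus>\<^bsub>E\<^esub> g = (\<lambda>x\<in>carrier M. f x \<oplus>\<^bsub>M\<^esub> g x)"
  and A_one: "\<one>\<^bsub>A\<^esub> = (\<lambda>x\<in>carrier M. x)"
  and A_add: "f \<oplus>\<^bsub>A\<^esub> g = (\<lambda>x\<in>carrier M. f x \<oplus>\<^bsub>M\<^esub> g x)"
  by (simp_all add: End_right_def End_bimod_def compose_def)

lemma A_compose: "f \<in> carrier A \<Longrightarrow> g \<in> carrier A \<Longrightarrow> compose (carrier M) f g \<in> carrier A"
  using A.m_closed[of f g] by (simp add: End_bimod_def)

lemma E_finsum_apply:
  assumes "g \<in> J \<rightarrow> carrier E" "x \<in> carrier M"
  shows "(\<Oplus>\<^bsub>E\<^esub>i\<in>J. g i) x = (\<Oplus>\<^bsub>M\<^esub>i\<in>J. g i x)"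
proof -
  have "(\<lambda>f. f x) \<in> hom (add_monoid E) (add_monoid M)"
    by (rule homI) (simp_all add: assms(2) E_add E_closed)
  then show ?thesis
    unfolding finsum_def
    by (rule hom_finprod_comm[OF E.a_comm_group M.a_comm_group]) (simp add: assms(1))
qed

lemma A_finsum_apply:
  assumes "g \<in> J \<rightarrow> carrier A" "x \<in> carrier M"
  shows "(\<Oplus>\<^bsub>A\<^esub>i\<in>J. g i) x = (\<Oplus>\<^bsub>M\<^esub>i\<in>J. g i x)"
proof -
  have "(\<lambda>f. f x) \<in> hom (add_monoid A) (add_monoid M)"
    by (rule homI) (simp_all add: assms(2) A_add A_closed)
  then show ?thesis
    unfolding finsum_def
    by (rule hom_finprod_comm[OF A.a_comm_group M.a_comm_group]) (simp add: assms(1))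
qed

section \<open>The centralizer, its actions on \<open>A\<close>, and the three tensor
  products\<close>

lemma R_closed [simp]: "r \<in> R \<Longrightarrow> r \<in> carrier M"
  by (simp add: ext_centralizer_def)

lemma R_commute: "r \<in> R \<Longrightarrow> n \<in> carrier N \<Longrightarrow> r \<otimes>\<^bsub>M\<^esub> phi n = phi n \<otimes>\<^bsub>M\<^esub> r"
  unfolding ext_centralizer_def by (rule sym) blast

text \<open>Left multiplication by any element keeps right linearity. That \<open>r\<close> commutes
  with the image of \<open>N\<close> gives left linearity, r phi(n) f(x) = phi(n) r f(x).\<close>

lemma A_lact_closed:
  assumes "r \<in> R" "f \<in> carrier A" shows "A_lact M r f \<in> carrier A"
  unfolding A_lact_def
proof (rule AI)
  show "right_linear (\<lambda>x. r \<otimes>\<^bsub>M\<^esub> f x)"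
    by (rule right_linear_mult[OF A_right_linear[OF assms(2)] R_closed[OF assms(1)]])
  fix n x assume n: "n \<in> carrier N" "x \<in> carrier M"
  note c = phi_closed[OF n(1)] R_closed[OF assms(1)] A_closed[OF assms(2) n(2)]
  have "r \<otimes>\<^bsub>M\<^esub> f (phi n \<otimes>\<^bsub>M\<^esub> x) = r \<otimes>\<^bsub>M\<^esub> phi n \<otimes>\<^bsub>M\<^esub> f x"
    unfolding A_left[OF assms(2) n] using c by (simp only: M.m_assoc)
  also have "\<dots> = phi n \<otimes>\<^bsub>M\<^esub> (r \<otimes>\<^bsub>M\<^esub> f x)"
    unfolding R_commute[OF assms(1) n(1)] using c by (simp only: M.m_assoc)
  finally show "r \<otimes>\<^bsub>M\<^esub> f (phi n \<otimes>\<^bsub>M\<^esub> x) = phi n \<otimes>\<^bsub>M\<^esub> (r \<otimes>\<^bsub>M\<^esub> f x)" .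
qed

text \<open>The two sides exchange roles: commuting with phi(n) now gives right linearity, and
  associativity gives left linearity.\<close>

lemma A_ract_closed:
  assumes "r \<in> R" "f \<in> carrier A" shows "A_ract M f r \<in> carrier A"
  unfolding A_ract_def
proof (rule AI)
  have "right_linear f" using assms(2) by (rule A_right_linear)
  then show "right_linear (\<lambda>x. f x \<otimes>\<^bsub>M\<^esub> r)"
    using R_closed[OF assms(1)] R_commute[OF assms(1)]
    unfolding right_linear_def by (simp add: M.l_distr M.m_assoc)
next
  fix n x assume n: "n \<in> carrier N" "x \<in> carrier M"
  show "f (phi n \<otimes>\<^bsub>M\<^esub> x) \<otimes>\<^bsub>M\<^esub> r = phi n \<otimes>\<^bsub>M\<^esub> (f x \<otimes>\<^bsub>M\<^esub> r)"
    unfolding A_left[OF assms(2) n] using assms n by (intro M.m_assoc) (simp_all add: A_closed)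
qed

text \<open>The rewrites state all inherited facts in the notions of the extension, with
  \<open>carrier M\<close> and ring addition in place of the components of
  \<open>add_monoid M\<close>. The instances \<open>MA\<close> and \<open>AA\<close> follow the same
  scheme.\<close>

sublocale MM: balanced_tensor "add_monoid M" "add_monoid M" "carrier N"
    "\<lambda>x n. x \<otimes>\<^bsub>M\<^esub> phi n" "\<lambda>n y. phi n \<otimes>\<^bsub>M\<^esub> y"
  rewrites "tensor_product (add_monoid M) (add_monoid M) (carrier N)
      (\<lambda>x n. x \<otimes>\<^bsub>M\<^esub> phi n) (\<lambda>n y. phi n \<otimes>\<^bsub>M\<^esub> y) = MMT"
    and "pure_tensor (add_monoid M) (add_monoid M) (carrier N)
      (\<lambda>x n. x \<otimes>\<^bsub>M\<^esub> phi n) (\<lambda>n y. phi n \<otimes>\<^bsub>M\<^esub> y) = mm"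
    and "carrier (add_monoid M) = carrier M"
    and "mult (add_monoid M) = add M"
  by (simp_all add: balanced_tensor_def balanced_tensor_axioms_def M.a_comm_group
      MM_tensor_def MM_pure_def)

sublocale MA: balanced_tensor "add_monoid M" "add_monoid A" R "mult M" "A_lact M"
  rewrites "tensor_product (add_monoid M) (add_monoid A) R (mult M) (A_lact M) = MAT"
    and "pure_tensor (add_monoid M) (add_monoid A) R (mult M) (A_lact M) = ma"
    and "carrier (add_monoid M) = carrier M"
    and "mult (add_monoid M) = add M"
    and "carrier (add_monoid A) = carrier A"
    and "mult (add_monoid A) = add A"
  by (simp_all add: balanced_tensor_def balanced_tensor_axioms_def M.a_comm_group A.a_comm_group[simplified]
      MA_tensor_def smash_def A_lact_closed)

sublocale AA: balanced_tensor "add_monoid A" "add_monoid A" R "A_ract M" "A_lact M"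
  rewrites "tensor_product (add_monoid A) (add_monoid A) R (A_ract M) (A_lact M) = AAT"
    and "pure_tensor (add_monoid A) (add_monoid A) R (A_ract M) (A_lact M) = aa"
    and "carrier (add_monoid A) = carrier A"
    and "mult (add_monoid A) = add A"
  by (simp_all add: balanced_tensor_def balanced_tensor_axioms_def A.a_comm_group[simplified]
      AA_tensor_def AA_pure_def A_lact_closed A_ract_closed)


section \<open>The actions of \<open>M\<close> on M \<otimes>_N M and evaluation of right linear
  maps on it\<close>

lemma MM_rmult_balanced:
  assumes "m \<in> carrier M"
  shows "MM.balanced MMT (\<lambda>x y. mm x (y \<otimes>\<^bsub>M\<^esub> m))"
proof (rule MM.balancedI)
  fix x n y assume c: "x \<in> carrier M" "n \<in> carrier N" "y \<in> carrier M"
  then show "mm (x \<otimes>\<^bsub>M\<^esub> phi n) (y \<otimes>\<^bsub>M\<^esub> m) = mm x (phi n \<otimes>\<^bsub>M\<^esub> y \<otimes>\<^bsub>M\<^esub> m)"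
    using assms MM.pure_act[of x n "y \<otimes>\<^bsub>M\<^esub> m"] by (simp add: M.m_assoc)
qed (use assms in \<open>simp_all add: M.l_distr MM.pure_add_left MM.pure_add_right\<close>)

lemma MM_lmult_balanced:
  assumes "m \<in> carrier M"
  shows "MM.balanced MMT (\<lambda>x y. mm (m \<otimes>\<^bsub>M\<^esub> x) y)"
proof (rule MM.balancedI)
  fix x n y assume c: "x \<in> carrier M" "n \<in> carrier N" "y \<in> carrier M"
  then show "mm (m \<otimes>\<^bsub>M\<^esub> (x \<otimes>\<^bsub>M\<^esub> phi n)) y = mm (m \<otimes>\<^bsub>M\<^esub> x) (phi n \<otimes>\<^bsub>M\<^esub> y)"
    using assms MM.pure_act[of "m \<otimes>\<^bsub>M\<^esub> x" n y] by (simp add: M.m_assoc)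
qed (use assms in \<open>simp_all add: M.r_distr MM.pure_add_left MM.pure_add_right\<close>)

lemma MM_rmult_pure:
  "m \<in> carrier M \<Longrightarrow> x \<in> carrier M \<Longrightarrow> y \<in> carrier M \<Longrightarrow>
    MM_rmult M N phi (mm x y) m = mm x (y \<otimes>\<^bsub>M\<^esub> m)"
  unfolding MM_rmult_def
  by (rule MM.tensor_lift_pure[OF MM.T_comm_group MM_rmult_balanced])

lemma MM_lmult_pure:
  "m \<in> carrier M \<Longrightarrow> x \<in> carrier M \<Longrightarrow> y \<in> carrier M \<Longrightarrow>
    MM_lmult M N phi m (mm x y) = mm (m \<otimes>\<^bsub>M\<^esub> x) y"
  unfolding MM_lmult_def
  by (rule MM.tensor_lift_pure[OF MM.T_comm_group MM_lmult_balanced])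

lemma MM_rmult_hom: "m \<in> carrier M \<Longrightarrow> (\<lambda>X. MM_rmult M N phi X m) \<in> hom MMT MMT"
  unfolding MM_rmult_def
  by (rule MM.tensor_lift_hom[OF MM.T_comm_group MM_rmult_balanced])

lemma MM_lmult_hom: "m \<in> carrier M \<Longrightarrow> MM_lmult M N phi m \<in> hom MMT MMT"
  unfolding MM_lmult_def
  by (rule MM.tensor_lift_hom[OF MM.T_comm_group MM_lmult_balanced])

text \<open>\<open>ev f X\<close> is \<open>f(X\<^sup>1) X\<^sup>2\<close>.\<close>

definition ev :: "('m \<Rightarrow> 'm) \<Rightarrow> (('m \<times> 'm) \<Rightarrow>\<^sub>0 int) set \<Rightarrow> 'm" where
  "ev f = tensor_lift (add_monoid M) (\<lambda>x y. f x \<otimes>\<^bsub>M\<^esub> y)"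

text \<open>Right linearity gives f(x phi(n)) y = f(x) (phi(n) y), which is the balancing condition.
  Hence \<open>ev f\<close> is f \<otimes> id followed by the multiplication M \<otimes>_N M
  \<rightarrow> M.\<close>

lemma ev_balanced:
  assumes "right_linear f"
  shows "MM.balanced (add_monoid M) (\<lambda>x y. f x \<otimes>\<^bsub>M\<^esub> y)"
  by (rule MM.balancedI)
    (use right_linearD[OF assms] in \<open>simp_all add: M.l_distr M.r_distr M.m_assoc\<close>)

lemma ev_pure:
  "right_linear f \<Longrightarrow> x \<in> carrier M \<Longrightarrow> y \<in> carrier M \<Longrightarrow> ev f (mm x y) = f x \<otimes>\<^bsub>M\<^esub> y"
  unfolding ev_def by (rule MM.tensor_lift_pure[OF M.a_comm_group ev_balanced])

lemma ev_hom: "right_linear f \<Longrightarrow> ev f \<in> hom MMT (add_monoid M)"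
  unfolding ev_def by (rule MM.tensor_lift_hom[OF M.a_comm_group ev_balanced])

lemma ev_closed: "right_linear f \<Longrightarrow> X \<in> carrier MMT \<Longrightarrow> ev f X \<in> carrier M"
  using hom_in_carrier[OF ev_hom] by simp

text \<open>Homomorphisms that agree on pure tensors are equal, so values of a function off
  \<open>carrier M\<close> do not influence \<open>ev\<close>. This compensates for
  \<open>right_linear\<close> being blind to such values.\<close>

lemma ev_cong:
  assumes "X \<in> carrier MMT" "right_linear f" "\<And>x. x \<in> carrier M \<Longrightarrow> g x = f x"
  shows "ev g X = ev f X"
proof -
  have g: "right_linear g" using assms(2,3) by (rule right_linear_cong)
  show ?thesis
    by (rule MM.tensor_hom_eqI[OF assms(1) ev_hom[OF g] ev_hom[OF assms(2)]])
      (simp add: ev_pure g assms(2,3))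
qed

lemma ev_rmult:
  assumes "X \<in> carrier MMT" "right_linear f" "m \<in> carrier M"
  shows "ev f (MM_rmult M N phi X m) = ev f X \<otimes>\<^bsub>M\<^esub> m"
proof (rule MM.tensor_hom_eqI[OF assms(1), where K = "add_monoid M"])
  show "(\<lambda>X. ev f (MM_rmult M N phi X m)) \<in> hom MMT (add_monoid M)"
    using hom_compose[OF MM_rmult_hom[OF assms(3)] ev_hom[OF assms(2)]] by (simp add: o_def)
  show "(\<lambda>X. ev f X \<otimes>\<^bsub>M\<^esub> m) \<in> hom MMT (add_monoid M)"
    by (rule homI)
      (use ev_closed[OF assms(2)] hom_mult[OF ev_hom[OF assms(2)]] assms(3) in \<open>simp_all add: M.l_distr\<close>)
  fix x y assume "x \<in> carrier M" "y \<in> carrier M"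
  then show "ev f (MM_rmult M N phi (mm x y) m) = ev f (mm x y) \<otimes>\<^bsub>M\<^esub> m"
    using assms by (simp add: MM_rmult_pure ev_pure right_linearD(1) M.m_assoc)
qed

lemma ev_lmult:
  assumes "X \<in> carrier MMT" "right_linear f" "m \<in> carrier M"
  shows "ev f (MM_lmult M N phi m X) = ev (\<lambda>x. f (m \<otimes>\<^bsub>M\<^esub> x)) X"
proof (rule MM.tensor_hom_eqI[OF assms(1), where K = "add_monoid M"])
  have f: "right_linear (\<lambda>x. f (m \<otimes>\<^bsub>M\<^esub> x))"
    using assms(2,3) by (rule right_linear_comp_mult)
  then show "ev (\<lambda>x. f (m \<otimes>\<^bsub>M\<^esub> x)) \<in> hom MMT (add_monoid M)"
    by (rule ev_hom)
  show "(\<lambda>X. ev f (MM_lmult M N phi m X)) \<in> hom MMT (add_monoid M)"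
    using hom_compose[OF MM_lmult_hom[OF assms(3)] ev_hom[OF assms(2)]] by (simp add: o_def)
  fix x y assume "x \<in> carrier M" "y \<in> carrier M"
  then show "ev f (MM_lmult M N phi m (mm x y)) = ev (\<lambda>x. f (m \<otimes>\<^bsub>M\<^esub> x)) (mm x y)"
    using assms by (simp add: MM_lmult_pure ev_pure[OF assms(2)] ev_pure[OF f])
qed

lemma ev_mult:
  assumes "X \<in> carrier MMT" "right_linear f" "m \<in> carrier M"
  shows "ev (\<lambda>x. m \<otimes>\<^bsub>M\<^esub> f x) X = m \<otimes>\<^bsub>M\<^esub> ev f X"
proof (rule MM.tensor_hom_eqI[OF assms(1), where K = "add_monoid M"])
  have f: "right_linear (\<lambda>x. m \<otimes>\<^bsub>M\<^esub> f x)"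
    using assms(2,3) by (rule right_linear_mult)
  then show "ev (\<lambda>x. m \<otimes>\<^bsub>M\<^esub> f x) \<in> hom MMT (add_monoid M)"
    by (rule ev_hom)
  show "(\<lambda>X. m \<otimes>\<^bsub>M\<^esub> ev f X) \<in> hom MMT (add_monoid M)"
    by (rule homI)
      (use ev_closed[OF assms(2)] hom_mult[OF ev_hom[OF assms(2)]] assms(3) in \<open>simp_all add: M.r_distr\<close>)
  fix x y assume "x \<in> carrier M" "y \<in> carrier M"
  then show "ev (\<lambda>x. m \<otimes>\<^bsub>M\<^esub> f x) (mm x y) = m \<otimes>\<^bsub>M\<^esub> ev f (mm x y)"
    using assms by (simp add: ev_pure[OF assms(2)] ev_pure[OF f] right_linearD(1) M.m_assoc)
qed

lemma ev_add:
  assumes "X \<in> carrier MMT" "right_linear f" "right_linear g"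
  shows "ev (\<lambda>x. f x \<oplus>\<^bsub>M\<^esub> g x) X = ev f X \<oplus>\<^bsub>M\<^esub> ev g X"
proof (rule MM.tensor_hom_eqI[OF assms(1), where K = "add_monoid M"])
  have s: "right_linear (\<lambda>x. f x \<oplus>\<^bsub>M\<^esub> g x)"
    using assms(2,3) by (rule right_linear_add)
  then show "ev (\<lambda>x. f x \<oplus>\<^bsub>M\<^esub> g x) \<in> hom MMT (add_monoid M)"
    by (rule ev_hom)
  show "(\<lambda>X. ev f X \<oplus>\<^bsub>M\<^esub> ev g X) \<in> hom MMT (add_monoid M)"
    by (rule homI)
      (use ev_closed[OF assms(2)] hom_mult[OF ev_hom[OF assms(2)]]
        ev_closed[OF assms(3)] hom_mult[OF ev_hom[OF assms(3)]] in \<open>simp_all add: M.a_ac\<close>)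
  fix x y assume "x \<in> carrier M" "y \<in> carrier M"
  then show "ev (\<lambda>x. f x \<oplus>\<^bsub>M\<^esub> g x) (mm x y) = ev f (mm x y) \<oplus>\<^bsub>M\<^esub> ev g (mm x y)"
    using assms by (simp add: ev_pure[OF s] ev_pure right_linearD(1) M.l_distr)
qed

section \<open>Evaluation at tensors that commute with \<open>N\<close>\<close>

lemma MM_centralizer_closed: "X \<in> MM_centralizer M N phi \<Longrightarrow> X \<in> carrier MMT"
  by (simp add: MM_centralizer_def)

text \<open>Left multiplication of \<open>X\<close> by phi(n) moves into the argument of
  \<open>f\<close>, while right multiplication comes out behind the value. On the centralizer the
  two coincide.\<close>

lemma ev_centralizer:
  assumes X: "X \<in> MM_centralizer M N phi" and f: "right_linear f" and n: "n \<in> carrier N"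
  shows "ev (\<lambda>x. f (phi n \<otimes>\<^bsub>M\<^esub> x)) X = ev f X \<otimes>\<^bsub>M\<^esub> phi n"
proof -
  have "MM_lmult M N phi (phi n) X = MM_rmult M N phi X (phi n)"
    using X n unfolding MM_centralizer_def by blast
  then show ?thesis
    using ev_lmult[OF MM_centralizer_closed[OF X] f phi_closed[OF n]]
      ev_rmult[OF MM_centralizer_closed[OF X] f phi_closed[OF n]] by metis
qed

text \<open>phi(n) comes out on the left because \<alpha> is left linear, and on the right because
  \<open>X\<close> commutes with \<open>N\<close>. Membership in \<open>R\<close> is what later lets
  such a coefficient cross the tensor sign.\<close>

lemma ev_in_R:
  assumes X: "X \<in> MM_centralizer M N phi" and \<alpha>: "\<alpha> \<in> carrier A"
  shows "ev \<alpha> X \<in> R"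
proof -
  note X' = MM_centralizer_closed[OF X] and r = A_right_linear[OF \<alpha>]
  have "phi n \<otimes>\<^bsub>M\<^esub> ev \<alpha> X = ev \<alpha> X \<otimes>\<^bsub>M\<^esub> phi n" if n: "n \<in> carrier N" for n
  proof -
    have "ev (\<lambda>x. \<alpha> (phi n \<otimes>\<^bsub>M\<^esub> x)) X = ev (\<lambda>x. phi n \<otimes>\<^bsub>M\<^esub> \<alpha> x) X"
      by (rule ev_cong[OF X' right_linear_mult[OF r phi_closed[OF n]]]) (rule A_left[OF \<alpha> n])
    then show ?thesis
      using ev_centralizer[OF X r n] ev_mult[OF X' r phi_closed[OF n]] by metis
  qed
  then show ?thesis
    unfolding ext_centralizer_def using ev_closed[OF r X'] by blast
qed

lemma insert_tensor_apply:
  "m \<in> carrier M \<Longrightarrow> insert_tensor M \<alpha> X m = ev (\<lambda>x. \<alpha> (m \<otimes>\<^bsub>M\<^esub> x)) X"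
  by (simp add: insert_tensor_def ev_def)

text \<open>Linearity in m has two sources: on the right it comes from \<open>X\<close> commuting
  with \<open>N\<close>, on the left from \<alpha> being left linear. The first tensor factors in
  the coproduct therefore lie in \<open>A\<close>.\<close>

lemma insert_tensor_closed:
  assumes X: "X \<in> MM_centralizer M N phi" and \<alpha>: "\<alpha> \<in> carrier A"
  shows "insert_tensor M \<alpha> X \<in> carrier A"
proof -
  note X' = MM_centralizer_closed[OF X]
  note r = right_linear_comp_mult[OF A_right_linear[OF \<alpha>]]
  have "(\<lambda>m\<in>carrier M. ev (\<lambda>x. \<alpha> (m \<otimes>\<^bsub>M\<^esub> x)) X) \<in> carrier A"
  proof (rule AI)
    show "right_linear (\<lambda>m. ev (\<lambda>x. \<alpha> (m \<otimes>\<^bsub>M\<^esub> x)) X)"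
      unfolding right_linear_def
    proof (intro conjI ballI)
      fix m assume m: "m \<in> carrier M"
      show "ev (\<lambda>x. \<alpha> (m \<otimes>\<^bsub>M\<^esub> x)) X \<in> carrier M"
        by (rule ev_closed[OF r[OF m] X'])
    next
      fix m m' assume m: "m \<in> carrier M" "m' \<in> carrier M"
      have "ev (\<lambda>x. \<alpha> ((m \<oplus>\<^bsub>M\<^esub> m') \<otimes>\<^bsub>M\<^esub> x)) X
          = ev (\<lambda>x. \<alpha> (m \<otimes>\<^bsub>M\<^esub> x) \<oplus>\<^bsub>M\<^esub> \<alpha> (m' \<otimes>\<^bsub>M\<^esub> x)) X"
        by (rule ev_cong[OF X' right_linear_add[OF r[OF m(1)] r[OF m(2)]]])
          (simp add: m M.l_distr right_linearD(2)[OF A_right_linear[OF \<alpha>]])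
      then show "ev (\<lambda>x. \<alpha> ((m \<oplus>\<^bsub>M\<^esub> m') \<otimes>\<^bsub>M\<^esub> x)) X
          = ev (\<lambda>x. \<alpha> (m \<otimes>\<^bsub>M\<^esub> x)) X \<oplus>\<^bsub>M\<^esub> ev (\<lambda>x. \<alpha> (m' \<otimes>\<^bsub>M\<^esub> x)) X"
        using ev_add[OF X' r[OF m(1)] r[OF m(2)]] by simp
    next
      fix m n assume m: "m \<in> carrier M" "n \<in> carrier N"
      have "ev (\<lambda>x. \<alpha> (m \<otimes>\<^bsub>M\<^esub> phi n \<otimes>\<^bsub>M\<^esub> x)) X = ev (\<lambda>x. \<alpha> (m \<otimes>\<^bsub>M\<^esub> (phi n \<otimes>\<^bsub>M\<^esub> x))) X"
        by (rule ev_cong[OF X' right_linear_comp_mult[OF r[OF m(1)] phi_closed[OF m(2)]]])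
          (simp add: m M.m_assoc)
      then show "ev (\<lambda>x. \<alpha> (m \<otimes>\<^bsub>M\<^esub> phi n \<otimes>\<^bsub>M\<^esub> x)) X = ev (\<lambda>x. \<alpha> (m \<otimes>\<^bsub>M\<^esub> x)) X \<otimes>\<^bsub>M\<^esub> phi n"
        using ev_centralizer[OF X r[OF m(1)] m(2)] by simp
    qed
  next
    fix n m assume m: "n \<in> carrier N" "m \<in> carrier M"
    have "ev (\<lambda>x. \<alpha> (phi n \<otimes>\<^bsub>M\<^esub> m \<otimes>\<^bsub>M\<^esub> x)) X = ev (\<lambda>x. phi n \<otimes>\<^bsub>M\<^esub> \<alpha> (m \<otimes>\<^bsub>M\<^esub> x)) X"
      by (rule ev_cong[OF X' right_linear_mult[OF r[OF m(2)] phi_closed[OF m(1)]]])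
        (simp add: m M.m_assoc A_left[OF \<alpha> m(1)])
    then show "ev (\<lambda>x. \<alpha> (phi n \<otimes>\<^bsub>M\<^esub> m \<otimes>\<^bsub>M\<^esub> x)) X = phi n \<otimes>\<^bsub>M\<^esub> ev (\<lambda>x. \<alpha> (m \<otimes>\<^bsub>M\<^esub> x)) X"
      using ev_mult[OF X' r[OF m(2)] phi_closed[OF m(1)]] by simp
  qed
  then show ?thesis
    by (simp add: insert_tensor_def ev_def)
qed

section \<open>The map to the endomorphism ring\<close>

abbreviation \<Phi> where "\<Phi> \<equiv> smash_to_End M N phi"

lemma left_mult_compose:
  assumes "\<alpha> \<in> carrier A"
  shows "compose (carrier M) (left_mult M m) \<alpha> = (\<lambda>x\<in>carrier M. m \<otimes>\<^bsub>M\<^esub> \<alpha> x)"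
  unfolding compose_def left_mult_def using A_closed[OF assms] by (intro restrict_ext) simp

lemma left_mult_compose_closed:
  assumes "m \<in> carrier M" "\<alpha> \<in> carrier A"
  shows "compose (carrier M) (left_mult M m) \<alpha> \<in> carrier E"
  unfolding left_mult_compose[OF assms(2)]
  by (rule EI[OF right_linear_mult[OF A_right_linear[OF assms(2)] assms(1)]])

text \<open>The balancing condition is associativity, (m r) \<alpha>(x) = m (r \<alpha>(x)); it
  makes \<open>\<Phi>\<close> well defined over \<open>R\<close>.\<close>

lemma left_mult_compose_balanced:
  "MA.balanced (add_monoid E) (\<lambda>m \<alpha>. compose (carrier M) (left_mult M m) \<alpha>)"
proof (rule MA.balancedI)
  fix m \<alpha> assume "m \<in> carrier M" "\<alpha> \<in> carrier A"
  then show "compose (carrier M) (left_mult M m) \<alpha> \<in> carrier (add_monoid E)"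
    by (simp add: left_mult_compose_closed)
next
  fix m m' \<alpha> assume c: "m \<in> carrier M" "m' \<in> carrier M" "\<alpha> \<in> carrier A"
  show "compose (carrier M) (left_mult M (m \<oplus>\<^bsub>M\<^esub> m')) \<alpha> =
    compose (carrier M) (left_mult M m) \<alpha> \<otimes>\<^bsub>add_monoid E\<^esub> compose (carrier M) (left_mult M m') \<alpha>"
    unfolding left_mult_compose[OF c(3)]
    using c by (simp add: E_add M.l_distr A_closed cong: restrict_cong)
next
  fix m \<alpha> \<alpha>' assume c: "m \<in> carrier M" "\<alpha> \<in> carrier A" "\<alpha>' \<in> carrier A"
  show "compose (carrier M) (left_mult M m) (\<alpha> \<oplus>\<^bsub>A\<^esub> \<alpha>') =
    compose (carrier M) (left_mult M m) \<alpha> \<otimes>\<^bsub>add_monoid E\<^esub> compose (carrier M) (left_mult M m) \<alpha>'"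
    unfolding left_mult_compose[OF c(2)] left_mult_compose[OF c(3)] left_mult_compose[OF A.a_closed[OF c(2,3)]]
    using c by (simp add: E_add A_add M.r_distr A_closed cong: restrict_cong)
next
  fix m r \<alpha> assume c: "m \<in> carrier M" "r \<in> R" "\<alpha> \<in> carrier A"
  show "compose (carrier M) (left_mult M (m \<otimes>\<^bsub>M\<^esub> r)) \<alpha> = compose (carrier M) (left_mult M m) (A_lact M r \<alpha>)"
    unfolding left_mult_compose[OF c(3)] left_mult_compose[OF A_lact_closed[OF c(2,3)]]
    using c by (simp add: A_lact_def M.m_assoc A_closed cong: restrict_cong)
qed

lemma \<Phi>_smash:
  "m \<in> carrier M \<Longrightarrow> \<alpha> \<in> carrier A \<Longrightarrow> \<Phi> (ma m \<alpha>) = compose (carrier M) (left_mult M m) \<alpha>"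
  unfolding smash_to_End_def
  by (rule MA.tensor_lift_pure[OF E.a_comm_group left_mult_compose_balanced])

lemma \<Phi>_hom: "\<Phi> \<in> hom MAT (add_monoid E)"
  unfolding smash_to_End_def
  by (rule MA.tensor_lift_hom[OF E.a_comm_group left_mult_compose_balanced])

lemma \<Phi>_closed: "X \<in> carrier MAT \<Longrightarrow> \<Phi> X \<in> carrier E"
  using hom_in_carrier[OF \<Phi>_hom] by simp

lemma \<Phi>_add: "X \<in> carrier MAT \<Longrightarrow> Y \<in> carrier MAT \<Longrightarrow> \<Phi> (X \<otimes>\<^bsub>MAT\<^esub> Y) = \<Phi> X \<oplus>\<^bsub>E\<^esub> \<Phi> Y"
  using hom_mult[OF \<Phi>_hom] by simp

lemma \<Phi>_finprod_apply:
  assumes "g \<in> J \<rightarrow> carrier MAT" "x \<in> carrier M"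
  shows "\<Phi> (finprod MAT g J) x = (\<Oplus>\<^bsub>M\<^esub>i\<in>J. \<Phi> (g i) x)"
proof -
  have "\<Phi> (finprod MAT g J) = (\<Oplus>\<^bsub>E\<^esub>i\<in>J. \<Phi> (g i))"
    unfolding finsum_def
    by (rule hom_finprod_comm[OF MA.T_comm_group E.a_comm_group \<Phi>_hom assms(1)])
  then show ?thesis
    using E_finsum_apply[of "\<lambda>i. \<Phi> (g i)" J x] assms \<Phi>_closed by (simp add: Pi_iff)
qed

lemma \<Phi>_smash_apply:
  "m \<in> carrier M \<Longrightarrow> \<alpha> \<in> carrier A \<Longrightarrow> x \<in> carrier M \<Longrightarrow> \<Phi> (ma m \<alpha>) x = m \<otimes>\<^bsub>M\<^esub> \<alpha> x"
  by (simp add: \<Phi>_smash left_mult_compose)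

end

section \<open>Inverting \<open>\<Phi>\<close> with the help of the quasibasis\<close>

locale left_D2_extension = ring_extension M N phi
  for M :: "('m, 'a) ring_scheme" (structure) and N :: "('n, 'b) ring_scheme" and phi :: "'n \<Rightarrow> 'm" +
  fixes I :: "'i set" and b :: "'i \<Rightarrow> (('m \<times> 'm) \<Rightarrow>\<^sub>0 int) set" and \<beta> :: "'i \<Rightarrow> 'm \<Rightarrow> 'm"
  assumes quasibasis: "left_D2_quasibasis M N phi I b \<beta>"
begin

lemma b_centralizer: "i \<in> I \<Longrightarrow> b i \<in> MM_centralizer M N phi"
  and \<beta>_closed: "i \<in> I \<Longrightarrow> \<beta> i \<in> carrier A"
  and quasibasis_eq: "m \<in> carrier M \<Longrightarrow>
    (\<Otimes>\<^bsub>MMT\<^esub>i\<in>I. MM_rmult M N phi (b i) (\<beta> i m)) = mm m \<one>\<^bsub>M\<^esub>"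
  using quasibasis unfolding left_D2_quasibasis_def by blast+

lemma b_closed: "i \<in> I \<Longrightarrow> b i \<in> carrier MMT"
  by (rule MM_centralizer_closed[OF b_centralizer])

text \<open>A dual basis formula: \<open>ev f\<close> is right M-linear and sends x \<otimes> 1 to
  f(x), so it turns the quasibasis equation at x into this one.\<close>

lemma ev_quasibasis:
  assumes f: "right_linear f" and x: "x \<in> carrier M"
  shows "(\<Oplus>\<^bsub>M\<^esub>i\<in>I. ev f (b i) \<otimes>\<^bsub>M\<^esub> \<beta> i x) = f x"
proof -
  have "(\<Oplus>\<^bsub>M\<^esub>i\<in>I. ev f (b i) \<otimes>\<^bsub>M\<^esub> \<beta> i x) = (\<Oplus>\<^bsub>M\<^esub>i\<in>I. ev f (MM_rmult M N phi (b i) (\<beta> i x)))"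
    by (rule M.finsum_cong')
      (auto simp: ev_rmult[OF b_closed f A_closed[OF \<beta>_closed x]] ev_closed[OF f b_closed] A_closed[OF \<beta>_closed x])
  also have "\<dots> = ev f (\<Otimes>\<^bsub>MMT\<^esub>i\<in>I. MM_rmult M N phi (b i) (\<beta> i x))"
    unfolding finsum_def
    by (rule hom_finprod_comm[OF MM.T_comm_group M.a_comm_group ev_hom[OF f], symmetric])
      (auto intro!: hom_in_carrier[OF MM_rmult_hom] A_closed[OF \<beta>_closed x] b_closed)
  also have "\<dots> = f x"
    using f x by (simp add: quasibasis_eq ev_pure right_linearD(1))
  finally show ?thesis .
qed

text \<open>The dual basis formula decomposes f as the sum over i of left multiplication by
  \<open>ev f (b i)\<close> after \<open>\<beta> i\<close>; \<open>\<Psi>\<close> records this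
  decomposition as a tensor.\<close>

definition \<Psi> :: "('m \<Rightarrow> 'm) \<Rightarrow> (('m \<times> ('m \<Rightarrow> 'm)) \<Rightarrow>\<^sub>0 int) set" where
  "\<Psi> f = (\<Otimes>\<^bsub>MAT\<^esub>i\<in>I. ma (ev f (b i)) (\<beta> i))"

lemma \<Psi>_term_closed: "right_linear f \<Longrightarrow> i \<in> I \<Longrightarrow> ma (ev f (b i)) (\<beta> i) \<in> carrier MAT"
  by (intro MA.pure_closed ev_closed b_closed \<beta>_closed)

lemma \<Psi>_closed: "right_linear f \<Longrightarrow> \<Psi> f \<in> carrier MAT"
  unfolding \<Psi>_def by (rule MA.T.finprod_closed) (auto intro: \<Psi>_term_closed)

lemma \<Phi>_\<Psi>:
  assumes "f \<in> carrier E"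
  shows "\<Phi> (\<Psi> f) = f"
proof (rule E_eqI[OF \<Phi>_closed assms])
  note r = E_right_linear[OF assms]
  show "\<Psi> f \<in> carrier MAT" by (rule \<Psi>_closed[OF r])
  fix x assume x: "x \<in> carrier M"
  have "\<Phi> (\<Psi> f) x = (\<Oplus>\<^bsub>M\<^esub>i\<in>I. \<Phi> (ma (ev f (b i)) (\<beta> i)) x)"
    unfolding \<Psi>_def by (rule \<Phi>_finprod_apply[OF _ x]) (auto intro: \<Psi>_term_closed[OF r])
  also have "\<dots> = (\<Oplus>\<^bsub>M\<^esub>i\<in>I. ev f (b i) \<otimes>\<^bsub>M\<^esub> \<beta> i x)"
    by (rule M.finsum_cong')
      (auto simp: \<Phi>_smash_apply[OF ev_closed[OF r b_closed] \<beta>_closed x]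
        ev_closed[OF r b_closed] A_closed[OF \<beta>_closed x])
  also have "\<dots> = f x"
    by (rule ev_quasibasis[OF r x])
  finally show "\<Phi> (\<Psi> f) x = f x" .
qed

lemma \<Psi>_cong:
  assumes "right_linear f" "\<And>x. x \<in> carrier M \<Longrightarrow> g x = f x"
  shows "\<Psi> g = \<Psi> f"
  unfolding \<Psi>_def
  by (rule MA.T.finprod_cong')
    (auto simp: ev_cong[OF b_closed assms] intro: \<Psi>_term_closed[OF assms(1)])

lemma \<Psi>_hom: "\<Psi> \<in> hom (add_monoid E) MAT"
proof (rule homI)
  fix f assume "f \<in> carrier (add_monoid E)"
  then show "\<Psi> f \<in> carrier MAT" by (simp add: \<Psi>_closed E_right_linear)
next
  fix f g assume "f \<in> carrier (add_monoid E)" "g \<in> carrier (add_monoid E)"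
  then have f: "right_linear f" and g: "right_linear g" by (simp_all add: E_right_linear)
  have "\<Psi> (f \<oplus>\<^bsub>E\<^esub> g) = \<Psi> (\<lambda>x. f x \<oplus>\<^bsub>M\<^esub> g x)"
    by (rule \<Psi>_cong[OF right_linear_add[OF f g]]) (simp add: E_add)
  also have "\<dots> = (\<Otimes>\<^bsub>MAT\<^esub>i\<in>I. ma (ev f (b i)) (\<beta> i) \<otimes>\<^bsub>MAT\<^esub> ma (ev g (b i)) (\<beta> i))"
    unfolding \<Psi>_def
    by (rule MA.T.finprod_cong')
      (auto simp: ev_add[OF b_closed f g] MA.pure_add_left[OF ev_closed[OF f b_closed] ev_closed[OF g b_closed] \<beta>_closed]
        intro!: \<Psi>_term_closed[OF f] \<Psi>_term_closed[OF g])
  also have "\<dots> = \<Psi> f \<otimes>\<^bsub>MAT\<^esub> \<Psi> g"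
    unfolding \<Psi>_def by (rule MA.T.finprod_multf) (auto intro!: \<Psi>_term_closed f g)
  finally show "\<Psi> (f \<otimes>\<^bsub>add_monoid E\<^esub> g) = \<Psi> f \<otimes>\<^bsub>MAT\<^esub> \<Psi> g"
    by simp
qed

lemma \<Psi>_smash:
  assumes m: "m \<in> carrier M" and \<alpha>: "\<alpha> \<in> carrier A"
  shows "\<Psi> (\<Phi> (ma m \<alpha>)) = ma m \<alpha>"
proof -
  note r = A_right_linear[OF \<alpha>]
  have R: "ev \<alpha> (b i) \<in> R" if "i \<in> I" for i
    by (rule ev_in_R[OF b_centralizer[OF that] \<alpha>])
  have lact: "A_lact M (ev \<alpha> (b i)) (\<beta> i) \<in> carrier A" if "i \<in> I" for i
    by (rule A_lact_closed[OF R[OF that] \<beta>_closed[OF that]])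
  have "\<Psi> (\<Phi> (ma m \<alpha>)) = \<Psi> (\<lambda>x. m \<otimes>\<^bsub>M\<^esub> \<alpha> x)"
    by (rule \<Psi>_cong[OF right_linear_mult[OF r m] \<Phi>_smash_apply[OF m \<alpha>]])
  \<comment> \<open>Pulling \<open>m\<close> out of \<open>ev\<close> leaves
    \<open>ev \<alpha> (b i)\<close>, which lies in \<open>R\<close> and so moves across the tensor
    sign onto \<open>\<beta> i\<close>. The first slot no longer depends on i, and the sum can be
    collected in the second.\<close>
  also have "\<dots> = (\<Otimes>\<^bsub>MAT\<^esub>i\<in>I. ma m (A_lact M (ev \<alpha> (b i)) (\<beta> i)))"
    unfolding \<Psi>_def
    by (rule MA.T.finprod_cong')
      (auto simp: ev_mult[OF b_closed r m] MA.pure_act[OF m R \<beta>_closed] intro!: MA.pure_closed m lact)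
  also have "\<dots> = ma m (\<Oplus>\<^bsub>A\<^esub>i\<in>I. A_lact M (ev \<alpha> (b i)) (\<beta> i))"
    unfolding finsum_def
  proof (rule hom_finprod_comm[OF A.a_comm_group MA.T_comm_group, symmetric])
    show "ma m \<in> hom (add_monoid A) MAT"
      by (rule homI) (simp_all add: m MA.pure_add_right)
  qed (simp add: lact)
  \<comment> \<open>The sum left in the second slot is the dual basis formula for \<alpha>, read as
    an identity in \<open>A\<close>.\<close>
  also have "(\<Oplus>\<^bsub>A\<^esub>i\<in>I. A_lact M (ev \<alpha> (b i)) (\<beta> i)) = \<alpha>"
  proof (rule E_eqI)
    show "(\<Oplus>\<^bsub>A\<^esub>i\<in>I. A_lact M (ev \<alpha> (b i)) (\<beta> i)) \<in> carrier E"
      by (rule A_subset_E, rule A.finsum_closed) (simp add: lact)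
    show "\<alpha> \<in> carrier E" by (rule A_subset_E[OF \<alpha>])
    fix x assume x: "x \<in> carrier M"
    have "(\<Oplus>\<^bsub>A\<^esub>i\<in>I. A_lact M (ev \<alpha> (b i)) (\<beta> i)) x = (\<Oplus>\<^bsub>M\<^esub>i\<in>I. A_lact M (ev \<alpha> (b i)) (\<beta> i) x)"
      by (rule A_finsum_apply[OF _ x]) (simp add: lact)
    also have "\<dots> = (\<Oplus>\<^bsub>M\<^esub>i\<in>I. ev \<alpha> (b i) \<otimes>\<^bsub>M\<^esub> \<beta> i x)"
      using x by (simp add: A_lact_def)
    finally show "(\<Oplus>\<^bsub>A\<^esub>i\<in>I. A_lact M (ev \<alpha> (b i)) (\<beta> i)) x = \<alpha> x"
      using ev_quasibasis[OF r x] by simp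
  qed
  finally show ?thesis .
qed

lemma \<Psi>_\<Phi>:
  assumes "X \<in> carrier MAT"
  shows "\<Psi> (\<Phi> X) = X"
  using assms
proof (induction rule: MA.tensor_induct)
  case (mult X Y)
  then show ?case
    using hom_mult[OF \<Psi>_hom, of "\<Phi> X" "\<Phi> Y"] by (simp add: \<Phi>_add \<Phi>_closed)
qed (rule \<Psi>_smash)

lemma \<Phi>_eqI:
  assumes "X \<in> carrier MAT" "Y \<in> carrier MAT" "\<Phi> X = \<Phi> Y"
  shows "X = Y"
  using assms \<Psi>_\<Phi> by metis

text \<open>Since \<open>\<Phi>\<close> is injective, whether a map into the smash product is balanced can be tested
  after applying \<open>\<Phi>\<close>; this replaces computing with the coproduct.\<close>

lemma balanced_via_\<Phi>:
  assumes F: "\<And>m \<alpha>. m \<in> carrier M \<Longrightarrow> \<alpha> \<in> carrier A \<Longrightarrow> F m \<alpha> \<in> carrier MAT"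
    and h: "h \<in> hom (add_monoid E) (add_monoid E)"
    and eq: "\<And>m \<alpha>. m \<in> carrier M \<Longrightarrow> \<alpha> \<in> carrier A \<Longrightarrow> \<Phi> (F m \<alpha>) = h (\<Phi> (ma m \<alpha>))"
  shows "MA.balanced MAT F"
proof (rule MA.balancedI)
  have add: "h (\<Phi> X \<oplus>\<^bsub>E\<^esub> \<Phi> Y) = h (\<Phi> X) \<oplus>\<^bsub>E\<^esub> h (\<Phi> Y)"
    if "X \<in> carrier MAT" "Y \<in> carrier MAT" for X Y
    using hom_mult[OF h] that by (simp add: \<Phi>_closed)
  show "F m \<alpha> \<in> carrier MAT" if "m \<in> carrier M" "\<alpha> \<in> carrier A" for m \<alpha>
    using that by (rule F)
  show "F (m \<oplus>\<^bsub>M\<^esub> m') \<alpha> = F m \<alpha> \<otimes>\<^bsub>MAT\<^esub> F m' \<alpha>"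
    if "m \<in> carrier M" "m' \<in> carrier M" "\<alpha> \<in> carrier A" for m m' \<alpha>
    using that by (intro \<Phi>_eqI) (simp_all add: F eq \<Phi>_add add MA.pure_add_left)
  show "F m (\<alpha> \<oplus>\<^bsub>A\<^esub> \<alpha>') = F m \<alpha> \<otimes>\<^bsub>MAT\<^esub> F m \<alpha>'"
    if "m \<in> carrier M" "\<alpha> \<in> carrier A" "\<alpha>' \<in> carrier A" for m \<alpha> \<alpha>'
    using that by (intro \<Phi>_eqI) (simp_all add: F eq \<Phi>_add add MA.pure_add_right)
  show "F (m \<otimes>\<^bsub>M\<^esub> r) \<alpha> = F m (A_lact M r \<alpha>)"
    if "m \<in> carrier M" "r \<in> R" "\<alpha> \<in> carrier A" for m r \<alpha>
    using that by (intro \<Phi>_eqI) (simp_all add: F eq MA.pure_act A_lact_closed)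
qed

text \<open>\<open>F\<close> is balanced by the previous lemma, so both sides are additive in
  \<open>Y\<close> and pure tensors decide. It is applied to each variable of the product, with
  \<open>h\<close> a one-sided multiplication in \<open>E\<close>.\<close>

lemma \<Phi>_lift:
  assumes F: "\<And>m \<alpha>. m \<in> carrier M \<Longrightarrow> \<alpha> \<in> carrier A \<Longrightarrow> F m \<alpha> \<in> carrier MAT"
    and h: "h \<in> hom (add_monoid E) (add_monoid E)"
    and eq: "\<And>m \<alpha>. m \<in> carrier M \<Longrightarrow> \<alpha> \<in> carrier A \<Longrightarrow> \<Phi> (F m \<alpha>) = h (\<Phi> (ma m \<alpha>))"
    and Y: "Y \<in> carrier MAT"
  shows "\<Phi> (tensor_lift MAT F Y) = h (\<Phi> Y)"
proof -
  have bal: "MA.balanced MAT F"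
    using F h eq by (rule balanced_via_\<Phi>)
  note lift = MA.tensor_lift_hom[OF MA.T_comm_group bal]
  show ?thesis
  proof (rule MA.tensor_hom_eqI[OF Y])
    show "(\<lambda>Y. \<Phi> (tensor_lift MAT F Y)) \<in> hom MAT (add_monoid E)"
      using hom_compose[OF lift \<Phi>_hom] by (simp add: o_def)
    show "(\<lambda>Y. h (\<Phi> Y)) \<in> hom MAT (add_monoid E)"
      using hom_compose[OF \<Phi>_hom h] by (simp add: o_def)
    fix m \<alpha> assume "m \<in> carrier M" "\<alpha> \<in> carrier A"
    then show "\<Phi> (tensor_lift MAT F (ma m \<alpha>)) = h (\<Phi> (ma m \<alpha>))"
      by (simp add: MA.tensor_lift_pure[OF MA.T_comm_group bal] eq)
  qed
qed

section \<open>The multiplication of the smash product and its image under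
  \<open>\<Phi>\<close>\<close>

abbreviation smult where "smult \<equiv> smash_mult_pure M N phi I b \<beta>"
abbreviation P where "P \<equiv> smash_product M N phi I b \<beta>"

text \<open>Here the tensors themselves are compared: (\<alpha>1 r)(m') = \<alpha>1(m') r puts r
  next to the tensor sign of M \<otimes>_R A, and crossing it gives r (\<alpha>2 \<circ>
  \<alpha>').\<close>

lemma smash_mult_pure_balanced:
  assumes m: "m \<in> carrier M" "m' \<in> carrier M" and \<alpha>': "\<alpha>' \<in> carrier A"
  shows "AA.balanced MAT (\<lambda>\<alpha>1 \<alpha>2. ma (m \<otimes>\<^bsub>M\<^esub> \<alpha>1 m') (compose (carrier M) \<alpha>2 \<alpha>'))"
proof (rule AA.balancedI)
  fix \<alpha>1 \<alpha>2 assume c: "\<alpha>1 \<in> carrier A" "\<alpha>2 \<in> carrier A"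
  show "ma (m \<otimes>\<^bsub>M\<^esub> \<alpha>1 m') (compose (carrier M) \<alpha>2 \<alpha>') \<in> carrier MAT"
    by (rule MA.pure_closed[OF M.m_closed[OF m(1) A_closed[OF c(1) m(2)]] A_compose[OF c(2) \<alpha>']])
next
  fix \<alpha>1 \<alpha>1' \<alpha>2 assume c: "\<alpha>1 \<in> carrier A" "\<alpha>1' \<in> carrier A" "\<alpha>2 \<in> carrier A"
  have "m \<otimes>\<^bsub>M\<^esub> (\<alpha>1 \<oplus>\<^bsub>A\<^esub> \<alpha>1') m' = m \<otimes>\<^bsub>M\<^esub> \<alpha>1 m' \<oplus>\<^bsub>M\<^esub> m \<otimes>\<^bsub>M\<^esub> \<alpha>1' m'"
    using m A_closed[OF c(1) m(2)] A_closed[OF c(2) m(2)] by (simp add: A_add M.r_distr)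
  then show "ma (m \<otimes>\<^bsub>M\<^esub> (\<alpha>1 \<oplus>\<^bsub>A\<^esub> \<alpha>1') m') (compose (carrier M) \<alpha>2 \<alpha>') =
      ma (m \<otimes>\<^bsub>M\<^esub> \<alpha>1 m') (compose (carrier M) \<alpha>2 \<alpha>') \<otimes>\<^bsub>MAT\<^esub> ma (m \<otimes>\<^bsub>M\<^esub> \<alpha>1' m') (compose (carrier M) \<alpha>2 \<alpha>')"
    using m A_closed[OF c(1) m(2)] A_closed[OF c(2) m(2)] A_compose[OF c(3) \<alpha>']
    by (simp add: MA.pure_add_left)
next
  fix \<alpha>1 \<alpha>2 \<alpha>2' assume c: "\<alpha>1 \<in> carrier A" "\<alpha>2 \<in> carrier A" "\<alpha>2' \<in> carrier A"
  have "compose (carrier M) (\<alpha>2 \<oplus>\<^bsub>A\<^esub> \<alpha>2') \<alpha>' = compose (carrier M) \<alpha>2 \<alpha>' \<oplus>\<^bsub>A\<^esub> compose (carrier M) \<alpha>2' \<alpha>'"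
    using A_closed[OF \<alpha>'] by (simp add: A_add compose_def cong: restrict_cong)
  then show "ma (m \<otimes>\<^bsub>M\<^esub> \<alpha>1 m') (compose (carrier M) (\<alpha>2 \<oplus>\<^bsub>A\<^esub> \<alpha>2') \<alpha>') =
      ma (m \<otimes>\<^bsub>M\<^esub> \<alpha>1 m') (compose (carrier M) \<alpha>2 \<alpha>') \<otimes>\<^bsub>MAT\<^esub> ma (m \<otimes>\<^bsub>M\<^esub> \<alpha>1 m') (compose (carrier M) \<alpha>2' \<alpha>')"
    using m A_closed[OF c(1) m(2)] A_compose[OF c(2) \<alpha>'] A_compose[OF c(3) \<alpha>']
    by (simp add: MA.pure_add_right)
next
  fix \<alpha>1 r \<alpha>2 assume c: "\<alpha>1 \<in> carrier A" "r \<in> R" "\<alpha>2 \<in> carrier A"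
  have 1: "compose (carrier M) (A_lact M r \<alpha>2) \<alpha>' = A_lact M r (compose (carrier M) \<alpha>2 \<alpha>')"
    using A_closed[OF \<alpha>'] by (simp add: A_lact_def compose_def cong: restrict_cong)
  have 2: "m \<otimes>\<^bsub>M\<^esub> A_ract M \<alpha>1 r m' = m \<otimes>\<^bsub>M\<^esub> \<alpha>1 m' \<otimes>\<^bsub>M\<^esub> r"
    using m A_closed[OF c(1) m(2)] R_closed[OF c(2)] by (simp add: A_ract_def M.m_assoc)
  show "ma (m \<otimes>\<^bsub>M\<^esub> A_ract M \<alpha>1 r m') (compose (carrier M) \<alpha>2 \<alpha>') =
      ma (m \<otimes>\<^bsub>M\<^esub> \<alpha>1 m') (compose (carrier M) (A_lact M r \<alpha>2) \<alpha>')"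
    unfolding 1 2
    using m A_closed[OF c(1) m(2)] by (intro MA.pure_act c(2) A_compose c(3) \<alpha>') simp
qed

lemma smult_term_closed:
  assumes "m \<in> carrier M" "\<alpha> \<in> carrier A" "m' \<in> carrier M" "\<alpha>' \<in> carrier A" "i \<in> I"
  shows "ma (m \<otimes>\<^bsub>M\<^esub> insert_tensor M \<alpha> (b i) m') (compose (carrier M) (\<beta> i) \<alpha>') \<in> carrier MAT"
  by (rule MA.pure_closed[OF M.m_closed[OF assms(1) A_closed[OF insert_tensor_closed[OF
    b_centralizer[OF assms(5)] assms(2)] assms(3)]] A_compose[OF \<beta>_closed[OF assms(5)] assms(4)]])

text \<open>The map induced on A \<otimes>_R A is additive, so it applies term by term to the sum
  defining the coproduct.\<close>

lemma smult_eq: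
  assumes m: "m \<in> carrier M" and \<alpha>: "\<alpha> \<in> carrier A" and m': "m' \<in> carrier M" and \<alpha>': "\<alpha>' \<in> carrier A"
  shows "smult m \<alpha> m' \<alpha>' =
    (\<Otimes>\<^bsub>MAT\<^esub>i\<in>I. ma (m \<otimes>\<^bsub>M\<^esub> insert_tensor M \<alpha> (b i) m') (compose (carrier M) (\<beta> i) \<alpha>'))"
proof -
  note bal = smash_mult_pure_balanced[OF m m' \<alpha>']
  let ?f = "\<lambda>\<alpha>1 \<alpha>2. ma (m \<otimes>\<^bsub>M\<^esub> \<alpha>1 m') (compose (carrier M) \<alpha>2 \<alpha>')"
  have ins: "insert_tensor M \<alpha> (b i) \<in> carrier A" if "i \<in> I" for i
    by (rule insert_tensor_closed[OF b_centralizer[OF that] \<alpha>])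
  have "smult m \<alpha> m' \<alpha>' = (\<Otimes>\<^bsub>MAT\<^esub>i\<in>I. tensor_lift MAT ?f (aa (insert_tensor M \<alpha> (b i)) (\<beta> i)))"
    unfolding smash_mult_pure_def coproduct_def
    by (rule hom_finprod_comm[OF AA.T_comm_group MA.T_comm_group
          AA.tensor_lift_hom[OF MA.T_comm_group bal]]) (simp add: ins \<beta>_closed)
  also have "\<dots> = (\<Otimes>\<^bsub>MAT\<^esub>i\<in>I. ?f (insert_tensor M \<alpha> (b i)) (\<beta> i))"
    by (rule MA.T.finprod_cong')
      (use assms in \<open>auto intro!: smult_term_closed simp: AA.tensor_lift_pure[OF MA.T_comm_group bal ins \<beta>_closed]\<close>)
  finally show ?thesis .
qed

lemma smult_closed:
  assumes "m \<in> carrier M" "\<alpha> \<in> carrier A" "m' \<in> carrier M" "\<alpha>' \<in> carrier A"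
  shows "smult m \<alpha> m' \<alpha>' \<in> carrier MAT"
  unfolding smult_eq[OF assms]
  by (rule MA.T.finprod_closed) (auto intro!: smult_term_closed assms)

text \<open>At x the left side is the sum of the m \<alpha>(m' b_i^1) b_i^2 \<beta>_i(\<alpha>'(x)),
  which the dual basis formula collapses to m \<alpha>(m' \<alpha>'(x)).\<close>

lemma \<Phi>_smult:
  assumes m: "m \<in> carrier M" and \<alpha>: "\<alpha> \<in> carrier A" and m': "m' \<in> carrier M" and \<alpha>': "\<alpha>' \<in> carrier A"
  shows "\<Phi> (smult m \<alpha> m' \<alpha>') = \<Phi> (ma m \<alpha>) \<otimes>\<^bsub>E\<^esub> \<Phi> (ma m' \<alpha>')"
proof (rule E_eqI)
  show "\<Phi> (smult m \<alpha> m' \<alpha>') \<in> carrier E"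
    by (intro \<Phi>_closed smult_closed assms)
  show "\<Phi> (ma m \<alpha>) \<otimes>\<^bsub>E\<^esub> \<Phi> (ma m' \<alpha>') \<in> carrier E"
    by (intro E.m_closed \<Phi>_closed MA.pure_closed assms)
  fix x assume x: "x \<in> carrier M"
  note r = right_linear_comp_mult[OF A_right_linear[OF \<alpha>] m']
  note ax = A_closed[OF \<alpha>' x]
  let ?g = "\<lambda>x. \<alpha> (m' \<otimes>\<^bsub>M\<^esub> x)"
  note ev = ev_closed[OF r b_closed] and \<beta>x = A_closed[OF \<beta>_closed ax]
  have "\<Phi> (smult m \<alpha> m' \<alpha>') x =
      (\<Oplus>\<^bsub>M\<^esub>i\<in>I. \<Phi> (ma (m \<otimes>\<^bsub>M\<^esub> insert_tensor M \<alpha> (b i) m') (compose (carrier M) (\<beta> i) \<alpha>')) x)"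
    unfolding smult_eq[OF assms]
    by (rule \<Phi>_finprod_apply[OF _ x]) (auto intro!: smult_term_closed assms)
  also have "\<dots> = (\<Oplus>\<^bsub>M\<^esub>i\<in>I. m \<otimes>\<^bsub>M\<^esub> (ev ?g (b i) \<otimes>\<^bsub>M\<^esub> \<beta> i (\<alpha>' x)))"
  proof (rule M.finsum_cong')
    fix i assume i: "i \<in> I"
    show "\<Phi> (ma (m \<otimes>\<^bsub>M\<^esub> insert_tensor M \<alpha> (b i) m') (compose (carrier M) (\<beta> i) \<alpha>')) x =
        m \<otimes>\<^bsub>M\<^esub> (ev ?g (b i) \<otimes>\<^bsub>M\<^esub> \<beta> i (\<alpha>' x))"
      unfolding insert_tensor_apply[OF m']
      using m ev[OF i] \<beta>x[OF i] x
      by (subst \<Phi>_smash_apply[OF _ A_compose[OF \<beta>_closed[OF i] \<alpha>'] x]) (simp_all add: compose_eq M.m_assoc)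
  qed (use m ev \<beta>x in auto)
  also have "\<dots> = m \<otimes>\<^bsub>M\<^esub> (\<Oplus>\<^bsub>M\<^esub>i\<in>I. ev ?g (b i) \<otimes>\<^bsub>M\<^esub> \<beta> i (\<alpha>' x))"
  proof -
    have "(\<lambda>y. m \<otimes>\<^bsub>M\<^esub> y) \<in> hom (add_monoid M) (add_monoid M)"
      by (rule homI) (simp_all add: m M.r_distr)
    then show ?thesis
      unfolding finsum_def
      by (rule hom_finprod_comm[OF M.a_comm_group M.a_comm_group, symmetric]) (use ev \<beta>x in auto)
  qed
  \<comment> \<open>The dual basis formula is used for \<open>?g\<close>, that is \<alpha> after
    left multiplication by m', at the point \<alpha>'(x).\<close>
  also have "\<dots> = m \<otimes>\<^bsub>M\<^esub> \<alpha> (m' \<otimes>\<^bsub>M\<^esub> \<alpha>' x)"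
    by (subst ev_quasibasis[OF r ax]) (rule refl)
  also have "\<dots> = (\<Phi> (ma m \<alpha>) \<otimes>\<^bsub>E\<^esub> \<Phi> (ma m' \<alpha>')) x"
    using m m' ax x by (simp add: E_mult \<Phi>_smash_apply[OF m' \<alpha>'] \<Phi>_smash_apply[OF m \<alpha>])
  finally show "\<Phi> (smult m \<alpha> m' \<alpha>') x = (\<Phi> (ma m \<alpha>) \<otimes>\<^bsub>E\<^esub> \<Phi> (ma m' \<alpha>')) x" .
qed

lemma E_lmult_hom: "f \<in> carrier E \<Longrightarrow> (\<lambda>g. f \<otimes>\<^bsub>E\<^esub> g) \<in> hom (add_monoid E) (add_monoid E)"
  by (rule homI) (simp_all add: E.r_distr)

lemma E_rmult_hom: "f \<in> carrier E \<Longrightarrow> (\<lambda>g. g \<otimes>\<^bsub>E\<^esub> f) \<in> hom (add_monoid E) (add_monoid E)"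
  by (rule homI) (simp_all add: E.l_distr)

text \<open>Under \<open>\<Phi>\<close> the dependence on the second factor becomes left
  multiplication by the fixed element \<open>\<Phi> (ma m \<alpha>)\<close> of \<open>E\<close>,
  which is additive.\<close>

lemma smult_balanced:
  assumes "m \<in> carrier M" "\<alpha> \<in> carrier A"
  shows "MA.balanced MAT (smult m \<alpha>)"
  by (rule balanced_via_\<Phi>[OF _ E_lmult_hom[of "\<Phi> (ma m \<alpha>)"]])
    (simp_all add: assms smult_closed \<Phi>_smult \<Phi>_closed)

lemma lift_smult_closed:
  assumes "m \<in> carrier M" "\<alpha> \<in> carrier A" "Y \<in> carrier MAT"
  shows "tensor_lift MAT (smult m \<alpha>) Y \<in> carrier MAT"
  by (rule MA.tensor_lift_closed[OF MA.T_comm_group smult_balanced[OF assms(1,2)] assms(3)])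

lemma \<Phi>_lift_smult:
  assumes "m \<in> carrier M" "\<alpha> \<in> carrier A" "Y \<in> carrier MAT"
  shows "\<Phi> (tensor_lift MAT (smult m \<alpha>) Y) = \<Phi> (ma m \<alpha>) \<otimes>\<^bsub>E\<^esub> \<Phi> Y"
  by (rule \<Phi>_lift[OF _ E_lmult_hom]) (simp_all add: assms smult_closed \<Phi>_smult \<Phi>_closed)

text \<open>The nested lifts in the product are handled from the inside. With the second factor
  already an arbitrary \<open>Y\<close>, \<open>\<Phi>\<close> turns the dependence on the first
  into right multiplication by \<open>\<Phi> Y\<close>.\<close>

lemma lift_smult_balanced:
  assumes "Y \<in> carrier MAT"
  shows "MA.balanced MAT (\<lambda>m \<alpha>. tensor_lift MAT (smult m \<alpha>) Y)"
  by (rule balanced_via_\<Phi>[OF _ E_rmult_hom[of "\<Phi> Y"]])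
    (simp_all add: assms lift_smult_closed \<Phi>_lift_smult \<Phi>_closed)

section \<open>Transport of the ring structure along \<open>\<Phi>\<close> and
  \<open>\<Psi>\<close>\<close>

lemma P_sel: "carrier P = carrier MAT" "\<one>\<^bsub>P\<^esub> = ma \<one>\<^bsub>M\<^esub> \<one>\<^bsub>A\<^esub>" "\<zero>\<^bsub>P\<^esub> = \<one>\<^bsub>MAT\<^esub>" "add P = mult MAT"
  by (simp_all add: smash_product_def)

lemma P_mult: "X \<otimes>\<^bsub>P\<^esub> Y = tensor_lift MAT (\<lambda>m \<alpha>. tensor_lift MAT (smult m \<alpha>) Y) X"
  by (simp add: smash_product_def)

lemma P_mult_closed: "X \<in> carrier MAT \<Longrightarrow> Y \<in> carrier MAT \<Longrightarrow> X \<otimes>\<^bsub>P\<^esub> Y \<in> carrier MAT"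
  unfolding P_mult by (rule MA.tensor_lift_closed[OF MA.T_comm_group lift_smult_balanced])

lemma \<Phi>_mult:
  assumes "X \<in> carrier MAT" "Y \<in> carrier MAT"
  shows "\<Phi> (X \<otimes>\<^bsub>P\<^esub> Y) = \<Phi> X \<otimes>\<^bsub>E\<^esub> \<Phi> Y"
  unfolding P_mult
  by (rule \<Phi>_lift[OF _ E_rmult_hom]) (simp_all add: assms lift_smult_closed \<Phi>_lift_smult \<Phi>_closed)

lemma add_monoid_P: "add_monoid P = MAT"
  by (simp add: P_sel)

text \<open>Both lifts are of balanced maps and so reduce to their values on pure tensors. By
  \<open>add_monoid_P\<close>, a finite sum in \<open>P\<close> is a \<open>finprod\<close> in
  \<open>MAT\<close>.\<close>

lemma P_mult_smash:
  assumes m: "m \<in> carrier M" and \<alpha>: "\<alpha> \<in> carrier A" and m': "m' \<in> carrier M" and \<alpha>': "\<alpha>' \<in> carrier A"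
  shows "ma m \<alpha> \<otimes>\<^bsub>P\<^esub> ma m' \<alpha>' =
    (\<Oplus>\<^bsub>P\<^esub>i\<in>I. ma (m \<otimes>\<^bsub>M\<^esub> insert_tensor M \<alpha> (b i) m') (compose (carrier M) (\<beta> i) \<alpha>'))"
proof -
  have "ma m \<alpha> \<otimes>\<^bsub>P\<^esub> ma m' \<alpha>' = tensor_lift MAT (smult m \<alpha>) (ma m' \<alpha>')"
    unfolding P_mult
    by (rule MA.tensor_lift_pure[OF MA.T_comm_group lift_smult_balanced[OF MA.pure_closed[OF m' \<alpha>']] m \<alpha>])
  also have "\<dots> = smult m \<alpha> m' \<alpha>'"
    by (rule MA.tensor_lift_pure[OF MA.T_comm_group smult_balanced[OF m \<alpha>] m' \<alpha>'])
  finally show ?thesis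
    unfolding finsum_def add_monoid_P smult_eq[OF assms] .
qed

lemma \<Phi>_one: "\<Phi> \<one>\<^bsub>P\<^esub> = \<one>\<^bsub>E\<^esub>"
  by (rule E_eqI)
    (simp_all add: P_sel \<Phi>_closed \<Phi>_smash_apply A_one[symmetric], simp add: E_one A_one)

lemma \<Phi>_bij: "bij_betw \<Phi> (carrier MAT) (carrier E)"
  by (rule bij_betw_byWitness[where f' = \<Psi>])
    (auto simp: \<Psi>_\<Phi> \<Phi>_\<Psi> \<Phi>_closed \<Psi>_closed E_right_linear)

lemma \<Phi>_ring_iso: "\<Phi> \<in> ring_iso P E"
proof (rule ring_iso_memI)
  show "bij_betw \<Phi> (carrier P) (carrier E)"
    unfolding P_sel by (rule \<Phi>_bij)
qed (simp_all add: P_sel(1,4) \<Phi>_closed \<Phi>_mult \<Phi>_add \<Phi>_one)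

text \<open>The ring axioms are known in \<open>E\<close>, so this is the direction that carries
  them to \<open>P\<close>. Multiplicativity is tested after applying the injective
  \<open>\<Phi>\<close>.\<close>

lemma \<Psi>_ring_iso: "\<Psi> \<in> ring_iso E P"
proof (rule ring_iso_memI)
  have one: "\<one>\<^bsub>P\<^esub> \<in> carrier MAT"
    by (simp add: P_sel)
  show "\<Psi> (f \<otimes>\<^bsub>E\<^esub> g) = \<Psi> f \<otimes>\<^bsub>P\<^esub> \<Psi> g" if "f \<in> carrier E" "g \<in> carrier E" for f g
    using that by (intro \<Phi>_eqI) (simp_all add: \<Phi>_\<Psi> \<Phi>_mult P_mult_closed \<Psi>_closed E_right_linear)
  show "\<Psi> (f \<oplus>\<^bsub>E\<^esub> g) = \<Psi> f \<oplus>\<^bsub>P\<^esub> \<Psi> g" if "f \<in> carrier E" "g \<in> carrier E" for f g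
    using that hom_mult[OF \<Psi>_hom] by (simp add: P_sel)
  show "\<Psi> \<one>\<^bsub>E\<^esub> = \<one>\<^bsub>P\<^esub>"
    unfolding \<Phi>_one[symmetric] by (rule \<Psi>_\<Phi>[OF one])
  show "bij_betw \<Psi> (carrier E) (carrier P)"
    unfolding P_sel
    by (rule bij_betw_byWitness[where f' = \<Phi>])
      (auto simp: \<Psi>_\<Phi> \<Phi>_\<Psi> \<Phi>_closed \<Psi>_closed E_right_linear)
qed (simp add: P_sel \<Psi>_closed E_right_linear)

lemma ring_P: "ring P"
proof -
  \<comment> \<open>Transport along \<open>\<Psi>\<close> yields a ring whose zero is the image of
    the zero of \<open>E\<close>; it has to be identified with the zero of \<open>P\<close>.\<close>
  have "\<Psi> \<zero>\<^bsub>E\<^esub> = \<zero>\<^bsub>P\<^esub>"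
    using hom_one[OF \<Psi>_hom E.a_group MA.T.is_group] by (simp add: P_sel)
  then have "P\<lparr>zero := \<Psi> \<zero>\<^bsub>E\<^esub>\<rparr> = P"
    by simp
  then show ?thesis
    using E.ring_iso_imp_img_ring[OF \<Psi>_ring_iso] by metis
qed

end

text \<open>The product formula has the coproduct expanded: \<alpha>_(1) is
  \<open>insert_tensor M \<alpha> (b i)\<close> and \<alpha>_(2) is \<open>\<beta> i\<close>. The
  values on pure tensors identify the additive map that is claimed to be an isomorphism.\<close>

theorem corollary4p5:
  fixes M :: "('m, 'a) ring_scheme" and N :: "('n, 'b) ring_scheme" and phi :: "'n \<Rightarrow> 'm"
    and I :: "'i set" and b :: "'i \<Rightarrow> (('m \<times> 'm) \<Rightarrow>\<^sub>0 int) set" and \<beta> :: "'i \<Rightarrow> 'm \<Rightarrow> 'm"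
  assumes "ring M" and "ring N" and "phi \<in> ring_hom N M"
    and "left_D2 M N phi"
    and "left_D2_quasibasis M N phi I b \<beta>"
  shows "ring (smash_product M N phi I b \<beta>) \<and>
    (\<forall>m\<in>carrier M. \<forall>\<alpha>\<in>carrier (End_bimod M N phi).
     \<forall>m'\<in>carrier M. \<forall>\<alpha>'\<in>carrier (End_bimod M N phi).
       smash M N phi m \<alpha> \<otimes>\<^bsub>smash_product M N phi I b \<beta>\<^esub> smash M N phi m' \<alpha>' =
       (\<Oplus>\<^bsub>smash_product M N phi I b \<beta>\<^esub>i\<in>I.
          smash M N phi (m \<otimes>\<^bsub>M\<^esub> insert_tensor M \<alpha> (b i) m') (compose (carrier M) (\<beta> i) \<alpha>'))) \<and>
    (\<forall>m\<in>carrier M. \<forall>\<alpha>\<in>carrier (End_bimod M N phi).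
       smash_to_End M N phi (smash M N phi m \<alpha>) = compose (carrier M) (left_mult M m) \<alpha>) \<and>
    smash_to_End M N phi \<in> ring_iso (smash_product M N phi I b \<beta>) (End_right M N phi)"
proof -
  interpret left_D2_extension M N phi I b \<beta>
    using assms by (simp add: left_D2_extension_def left_D2_extension_axioms_def
        ring_extension_def ring_extension_axioms_def)
  show ?thesis
    using ring_P P_mult_smash \<Phi>_smash \<Phi>_ring_iso by blast
qed

end
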